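(* There exist absolute real constants $d_1\in[1.174,1.175)$ and $d_2\in[1.822,1.823)$ (i.e. $d_1=1.174\ldots$, $d_2=1.822\ldots$) such that for every $f\in\mathcal{S}_b$ with Taylor expansion $f(z)=z+a_2z^2+a_3z^3+\cdots$ in $\mathbb{D}$ one has (i) $|a_4|-|a_3|\le d_1$, (ii) $|a_5|-|a_4|\le d_2$.
   Context: Let $\mathbb{D}=\{z\in\mathbb{C}:|z|<1\}$. $\mathcal{S}$ is the class of functions $f$ that are analytic and univalent (injective) in $\mathbb{D}$ with expansion $f(z)=z+a_2z^2+a_3z^3+\cdots$. $\mathcal{S}_b\subset\mathcal{S}$ is the class of (normalized) bi-univalent functions: those $f\in\mathcal{S}$ whose inverse function $f^{-1}$ is also univalent in $\mathbb{D}$, meaning that the inverse of $f$ near the origin (with $f^{-1}(0)=0$) extends to an analytic univalent function on $\mathbb{D}$. (For example $z$, $z/(1-z)$ and $\frac12\log\frac{1+z}{1-z}$ belong to $\mathcal{S}_b$.) *)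

theory Defs
  imports "HOL-Complex_Analysis.Complex_Analysis"
begin

definition class_S :: "(complex \<Rightarrow> complex) set" where
  "class_S = {f. f holomorphic_on ball 0 1 \<and> inj_on f (ball 0 1) \<and> f 0 = 0 \<and> deriv f 0 = 1}"

(* The inverse inv_into (ball 0 1) f is only meaningful on f ` ball 0 1, which is a
   neighbourhood of 0 but need not contain the unit disc; g is the analytic
   continuation to the unit disc of its germ at 0. *)
definition class_Sb :: "(complex \<Rightarrow> complex) set" where
  "class_Sb = {f \<in> class_S. \<exists>g. g holomorphic_on ball 0 1 \<and> inj_on g (ball 0 1) \<and>
     (\<forall>\<^sub>F w in nhds 0. g w = inv_into (ball 0 1) f w)}"

end

theory Submission
  imports Defs
begin

text \<open>
  If $f \in \mathcal{S}$ and $b^k = z / f$ with $b(0) = 1$, then $b(z^k)/z$ is injective on the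
  punctured disc, so Gronwall's area theorem gives $\sum_{n \ge 1} (kn - 1) |b_n|^2 \le 1$ for the
  Taylor coefficients of $b$. Write $x, y, w, v$ for $b_1, \dots, b_4$ in the case $k = 2$; then
  $a_2, \dots, a_5$ are polynomials in them. For a bi-univalent $f$ the same inequality for the
  inverse reads $|x|^2 + 3 |x^2 + y|^2 \le 1$, and together with $|x|^2 + 3 |y|^2 \le 1$ this
  forces $|x|^2 \le 2/3$.

  Differences of moduli are estimated by $|u| - |v| \le |u + \kappa v|$ for $|\kappa| \le 1$ with
  $\kappa$ a multiple of $x$. The choices $4x/3$ for $|a_4| - |a_3|$ and $6x/5$ for
  $|a_5| - |a_4|$ suffice, except for $|a_4| - |a_3|$ when $3/4 < |x| \le \sqrt{2/3}$;
  there the case $k = 3$ of the area inequality replaces $k = 2$.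
\<close>

section \<open>Gronwall's area theorem\<close>

text \<open>The usual proof of the area theorem computes the area enclosed by the image of a circle
  and so needs Jordan curves. Here the image of an annulus \<open>\<rho> < |z| < r\<close> is
  compared with a disc that contains it, which takes only injectivity and a change of variables.
  Both areas grow like \<open>pi / \<rho>^2\<close>, so the radius of the disc must be known up to
  an error of smaller order than \<open>\<rho>\<close>; this requirement shapes the annulus
  estimate. Bi-univalence enters through one inequality for the first two root coefficients of the
  inverse. It is used twice: for the bound on \<open>|x|\<close>, which keeps the multipliers
  \<open>\<kappa>\<close> admissible, and for a sign condition when \<open>|x|\<close> is large. The
  numerical estimates need not be sharp: the witnesses lie near the right ends of the prescribed
  intervals, and the slack lets powers be replaced by chords and tangents with rational
  data.\<close>

no_notation fps_nth (infixl \<open>$\<close> 75)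

text \<open>Areas are obtained from the change-of-variables formula in \<open>real^2\<close>, whose
  Jacobian is the determinant of a matrix; complex maps reach it in these coordinates.\<close>

lemma has_derivative_complex_plane:
  fixes K :: "complex \<Rightarrow> complex" and v :: "real^2"
  assumes "(K has_derivative K') (at (Complex (v $ 1) (v $ 2)))"
  shows "((\<lambda>v::real^2. vector [Re (K (Complex (v $ 1) (v $ 2))), Im (K (Complex (v $ 1) (v $ 2)))] :: real^2)
     has_derivative (\<lambda>h. vector [Re (K' (Complex (h $ 1) (h $ 2))), Im (K' (Complex (h $ 1) (h $ 2)))])) (at v within S)"
proof -
  have c: "Complex (x $ 1) (x $ 2) = of_real (x $ 1) + \<i> * of_real (x $ 2)" for x :: "real^2"
    by (simp add: complex_eq_iff)
  have l: "((\<lambda>v::real^2. Complex (v $ 1) (v $ 2)) has_derivative (\<lambda>h. Complex (h $ 1) (h $ 2))) (at v within S)"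
    unfolding c by (auto intro!: derivative_eq_intros bounded_linear.has_derivative[OF bounded_linear_vec_nth])
  have k: "((\<lambda>v::real^2. K (Complex (v $ 1) (v $ 2))) has_derivative (\<lambda>h. K' (Complex (h $ 1) (h $ 2)))) (at v within S)"
    by (rule has_derivative_compose[OF l assms])
  have v: "vector [Re z, Im z] = Re z *\<^sub>R (axis 1 1 :: real^2) + Im z *\<^sub>R axis 2 1" for z
    by (simp add: vec_eq_iff forall_2 axis_def)
  show ?thesis unfolding v
    by (intro has_derivative_add has_derivative_scaleR_left has_derivative_Re has_derivative_Im k)
qed

text \<open>Fubini is applied in \<open>real \<times> real\<close> and carried to
  \<open>real^2\<close> by a change of coordinates that sends boxes to boxes and preserves their
  content.\<close>

lemma integral_cbox_plane:
  fixes F :: "complex \<Rightarrow> real"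
  assumes "continuous_on (cbox (Complex a c) (Complex b d)) F"
  shows "((\<lambda>v::real^2. F (Complex (v $ 1) (v $ 2))) has_integral
     integral {a..b} (\<lambda>x. integral {c..d} (\<lambda>y. F (Complex x y)))) (cbox (vector [a,c]) (vector [b,d]))"
proof -
  let ?G = "\<lambda>(x,y). F (Complex x y)"
  have c: "Complex x y = of_real x + \<i> * of_real y" for x y
    by (simp add: complex_eq_iff)
  have co: "continuous_on (cbox (a,c) (b,d)) ?G"
    unfolding c case_prod_unfold
    by (rule continuous_on_compose2[OF assms]) (auto intro!: continuous_intros simp: in_cbox_complex_iff cbox_Pair_eq)
  have 1: "(?G has_integral integral {a..b} (\<lambda>x. integral {c..d} (\<lambda>y. F (Complex x y)))) (cbox (a,c) (b,d))"
    using integral_prod_continuous[OF co] integrable_continuous[OF co] 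
    by (simp add: has_integral_iff cbox_interval)
  let ?g = "\<lambda>v::real^2. (v $ 1, v $ 2)" and ?h = "\<lambda>p. vector [fst p, snd p] :: real^2"
  have g: "?g ` cbox u v = cbox (u $ 1, u $ 2) (v $ 1, v $ 2)" for u v :: "real^2"
  proof -
    have "p \<in> ?g ` cbox u v" if "p \<in> cbox (u $ 1, u $ 2) (v $ 1, v $ 2)" for p
      using that by (intro image_eqI[of _ _ "?h p"]) (auto simp: mem_box_cart forall_2 cbox_Pair_eq)
    thus ?thesis by (auto simp: mem_box_cart forall_2 cbox_Pair_eq)
  qed
  have h: "?h ` cbox u v = cbox (?h u) (?h v)" for u v :: "real \<times> real"
  proof -
    have "p \<in> ?h ` cbox u v" if "p \<in> cbox (?h u) (?h v)" for p
    proof (intro image_eqI[of _ _ "?g p"])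
      show "?g p \<in> cbox u v"
        using that by (cases u; cases v) (auto simp: mem_box_cart forall_2 cbox_Pair_eq)
    qed (simp add: vec_eq_iff forall_2)
    thus ?thesis by (cases u; cases v) (auto simp: mem_box_cart forall_2 cbox_Pair_eq)
  qed
  have cont: "measure lborel (cbox (u $ 1, u $ 2) (v $ 1, v $ 2)) = measure lborel (cbox u v)" for u v :: "real^2"
    using forall_2[of "\<lambda>i. u $ i \<le> v $ i"]
    by (auto simp: content_Pair content_cbox_if_cart interval_eq_empty_cart not_less UNIV_2 not_le content_real_if) (meson not_le)
  have "((\<lambda>x. ?G (?g x)) has_integral (1/1) *\<^sub>R integral {a..b} (\<lambda>x. integral {c..d} (\<lambda>y. F (Complex x y)))) (?h ` cbox (a,c) (b,d))"
  proof (rule has_integral_twiddle[OF _ _ _ _ _ _ _ 1])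
    show "\<exists>w z. ?g ` cbox u v = cbox w z" for u v using g by blast
    show "\<exists>w z. ?h ` cbox u v = cbox w z" for u v using h by blast
    show "measure lborel (?g ` cbox u v) = 1 * measure lborel (cbox u v)" for u v using g cont by simp
  qed (auto simp: vec_eq_iff forall_2 intro!: continuous_intros)
  thus ?thesis by (simp add: h)
qed

text \<open>
  The derivative of \<open>K\<close> is multiplication by \<open>D\<close> followed by the real-linear map
  \<open>w \<mapsto> w - e * cnj w\<close>, which has determinant \<open>1 - |e|\<^sup>2\<close>.
\<close>

lemma area_injective_image_le:
  fixes K D :: "complex \<Rightarrow> complex" and e :: complex
  assumes der: "\<And>z. z \<in> box (Complex a c) (Complex b d) \<Longrightarrow> (K has_derivative (\<lambda>h. D z * h - e * cnj (D z * h))) (at z)"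
    and inj: "inj_on K (box (Complex a c) (Complex b d))"
    and bd: "\<And>z. z \<in> box (Complex a c) (Complex b d) \<Longrightarrow> norm (K z) \<le> R"
    and D: "continuous_on (cbox (Complex a c) (Complex b d)) D" and e: "norm e \<le> 1" and R: "R \<ge> 0"
  shows "(1 - norm e ^ 2) * integral {a..b} (\<lambda>x. integral {c..d} (\<lambda>y. norm (D (Complex x y)) ^ 2)) \<le> pi * R\<^sup>2"
proof -
  let ?c = "\<lambda>v::real^2. Complex (v $ 1) (v $ 2)"
  let ?K = "\<lambda>v::real^2. vector [Re (K (?c v)), Im (K (?c v))] :: real^2"
  define K' where "K' = (\<lambda>z h. D z * h - e * cnj (D z * h))"
  let ?K' = "\<lambda>v::real^2. \<lambda>h::real^2. vector [Re (K' (?c v) (?c h)), Im (K' (?c v) (?c h))] :: real^2"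
  let ?B = "box (vector [a,c]) (vector [b,d]) :: (real^2) set"
  have B: "?c v \<in> box (Complex a c) (Complex b d)" if "v \<in> ?B" for v
    using that by (auto simp: mem_box_cart forall_2 in_box_complex_iff)
  have der': "(?K has_derivative ?K' v) (at v within ?B)" if "v \<in> ?B" for v
    by (rule has_derivative_complex_plane) (use der[OF B[OF that]] in \<open>simp add: K'_def\<close>)
  have inj': "inj_on ?K ?B"
  proof (rule inj_onI)
    fix u v assume uv: "u \<in> ?B" "v \<in> ?B" "?K u = ?K v"
    hence "K (?c u) = K (?c v)" by (auto simp: vec_eq_iff forall_2 complex_eq_iff)
    hence "?c u = ?c v" using inj B uv by (auto dest: inj_onD)
    thus "u = v" by (simp add: vec_eq_iff forall_2)
  qed
  have det: "\<bar>det (matrix (?K' v))\<bar> = (1 - norm e ^ 2) * norm (D (?c v)) ^ 2" for v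
  proof -
    have "det (matrix (?K' v)) = (1 - norm e ^ 2) * norm (D (?c v)) ^ 2"
      unfolding det_2 matrix_def K'_def cmod_power2
      by (simp add: axis_def) algebra
    moreover have "norm e ^ 2 \<le> 1" using e by (simp add: power_le_one)
    ultimately show ?thesis by simp
  qed
  have "continuous_on (cbox (Complex a c) (Complex b d)) (\<lambda>z. (1 - norm e ^ 2) * norm (D z) ^ 2)"
    by (intro continuous_intros D)
  from integral_cbox_plane[OF this]
  have I: "((\<lambda>v. \<bar>det (matrix (?K' v))\<bar>) has_integral (1 - norm e ^ 2) * integral {a..b} (\<lambda>x. integral {c..d} (\<lambda>y. norm (D (Complex x y)) ^ 2))) ?B"
    by (simp add: det has_integral_open_interval)
  have m: "?K ` ?B \<in> lmeasurable \<and> measure lebesgue (?K ` ?B) = (1 - norm e ^ 2) * integral {a..b} (\<lambda>x. integral {c..d} (\<lambda>y. norm (D (Complex x y)) ^ 2))"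
    by (subst has_measure_differentiable_image[OF _ der' inj'])  (use I in auto)
  have "?K ` ?B \<subseteq> cball 0 R"
  proof clarify
    fix v assume "v \<in> ?B"
    from bd[OF B[OF this]] show "?K v \<in> cball 0 R"
      by (simp add: norm_vec_def L2_set_def sum_2 cmod_def)
  qed
  hence "measure lebesgue (?K ` ?B) \<le> measure lebesgue (cball (0::real^2) R)"
    using m by (intro measure_mono_fmeasurable) auto
  also have "\<dots> = pi * R\<^sup>2"
    using R by (simp add: content_cball unit_ball_vol_2)
  finally show ?thesis using m by simp
qed

section \<open>Mean values on circles and truncated power series\<close>

lemma circle_mean_value:
  assumes "g holomorphic_on ball 0 1" "0 < r" "r < 1"
  shows "((\<lambda>t. g (of_real r * cis t)) has_integral 2 * of_real pi * g 0) {0..2*pi}"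
proof -
  have "((\<lambda>u. g u / (u - 0)) has_contour_integral (2 * of_real pi * \<i> * g 0)) (circlepath 0 r)"
    by (rule Cauchy_integral_circlepath_simple)
       (use assms in \<open>auto intro!: holomorphic_on_subset[OF assms(1)]\<close>)
  hence "((\<lambda>t. g (of_real r * cis t) * \<i>) has_integral (2 * of_real pi * \<i> * g 0)) {0..2*pi}"
    using assms(2) unfolding circlepath_def
    by (subst (asm) has_contour_integral_part_circlepath_iff) (auto simp: mult_ac)
  from has_integral_mult_right[OF this, of "-\<i>"] show ?thesis by (simp add: mult_ac)
qed

text \<open>Truncated Parseval: splitting off \<open>d 0\<close> leaves \<open>z * F z\<close>,
  which vanishes at 0, so the cross term integrates to 0 by the mean value property. The remainder
  \<open>G\<close> finally contributes a nonnegative integral. No series is integrated term by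
  term.\<close>

lemma circle_bessel:
  fixes d :: "nat \<Rightarrow> complex"
  assumes G: "G holomorphic_on ball 0 1" and r: "0 < r" "r < 1"
  shows "2 * pi * (\<Sum>k<M. norm (d k) ^ 2 * r ^ (2 * k)) \<le>
    integral {0..2*pi} (\<lambda>t. norm ((\<Sum>k<M. d k * (of_real r * cis t) ^ k) + (of_real r * cis t) ^ M * G (of_real r * cis t)) ^ 2)"
proof (induction M arbitrary: d)
  case 0
  have "continuous_on {0..2*pi} (\<lambda>t. norm (G (of_real r * cis t)) ^ 2)"
    using r by (auto intro!: continuous_intros continuous_on_compose2[OF holomorphic_on_imp_continuous_on[OF G]] simp: norm_mult)
  from integral_nonneg[OF integrable_continuous_interval[OF this]] show ?case by simp
next
  case (Suc M)
  define F where "F = (\<lambda>z. (\<Sum>k<M. d (Suc k) * z ^ k) + z ^ M * G z)"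
  have F: "F holomorphic_on ball 0 1" unfolding F_def by (intro holomorphic_intros G)
  let ?z = "\<lambda>t. of_real r * cis t :: complex"
  have eq: "(\<Sum>k<Suc M. d k * z ^ k) + z ^ Suc M * G z = d 0 + z * F z" for z
    unfolding F_def sum.lessThan_Suc_shift
    by (simp add: sum_distrib_left algebra_simps)
  have zF: "(\<lambda>z. z * F z) holomorphic_on ball 0 1" by (intro holomorphic_intros F)
  have "((\<lambda>t. ?z t * F (?z t)) has_integral 0) {0..2*pi}"
    using circle_mean_value[OF zF r] by simp
  from has_integral_Re[OF has_integral_mult_right[OF this, of "2 * cnj (d 0)"]]
  have "((\<lambda>t. Re (2 * cnj (d 0) * (?z t * F (?z t)))) has_integral 0) {0..2*pi}"
    by (simp only: mult_zero_right zero_complex.simps)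
  moreover have "continuous_on {0..2*pi} (\<lambda>t. norm (F (?z t)) ^ 2)"
    using r by (auto intro!: continuous_intros continuous_on_compose2[OF holomorphic_on_imp_continuous_on[OF F]] simp: norm_mult)
  hence "(\<lambda>t. norm (F (?z t)) ^ 2) integrable_on {0..2*pi}" by (rule integrable_continuous_interval)
  hence "((\<lambda>t. r\<^sup>2 * norm (F (?z t)) ^ 2) has_integral (r\<^sup>2 * integral {0..2*pi} (\<lambda>t. norm (F (?z t)) ^ 2))) {0..2*pi}"
    by (intro has_integral_mult_right integrable_integral)
  moreover have "((\<lambda>t. norm (d 0) ^ 2) has_integral (2 * pi * norm (d 0) ^ 2)) {0..2*pi}"
    using has_integral_const_real[of "norm (d 0) ^ 2" 0 "2*pi"] by simp
  ultimately have "((\<lambda>t. norm (d 0) ^ 2 + r\<^sup>2 * norm (F (?z t)) ^ 2 + Re (2 * cnj (d 0) * (?z t * F (?z t)))) has_integral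
      (2 * pi * norm (d 0) ^ 2 + r\<^sup>2 * integral {0..2*pi} (\<lambda>t. norm (F (?z t)) ^ 2) + 0)) {0..2*pi}"
    by (intro has_integral_add)
  moreover have "norm (d 0) ^ 2 + r\<^sup>2 * norm (F (?z t)) ^ 2 + Re (2 * cnj (d 0) * (?z t * F (?z t)))
     = norm (d 0 + ?z t * F (?z t)) ^ 2" for t
  proof -
    have "norm (a + b) ^ 2 = norm a ^ 2 + norm b ^ 2 + Re (2 * cnj a * b)" for a b :: complex
      by (simp add: cmod_power2) algebra
    from this[of "d 0" "?z t * F (?z t)"] r show ?thesis by (simp add: norm_mult power_mult_distrib)
  qed
  ultimately have I: "integral {0..2*pi} (\<lambda>t. norm (d 0 + ?z t * F (?z t)) ^ 2) =
      2 * pi * norm (d 0) ^ 2 + r\<^sup>2 * integral {0..2*pi} (\<lambda>t. norm (F (?z t)) ^ 2)"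
    by (simp add: has_integral_iff)
  have "2 * pi * (\<Sum>k<Suc M. norm (d k) ^ 2 * r ^ (2 * k)) =
     2 * pi * norm (d 0) ^ 2 + r\<^sup>2 * (2 * pi * (\<Sum>k<M. norm (d (Suc k)) ^ 2 * r ^ (2 * k)))"
    unfolding sum.lessThan_Suc_shift by (simp add: sum_distrib_left algebra_simps power2_eq_square)
  also have "\<dots> \<le> 2 * pi * norm (d 0) ^ 2 + r\<^sup>2 * integral {0..2*pi} (\<lambda>t. norm (F (?z t)) ^ 2)"
    unfolding F_def by (intro add_left_mono mult_left_mono Suc.IH) auto
  finally show ?case unfolding eq I .
qed

text \<open>A holomorphic factor in place of the tail lets the area computation work with finite
  sums. The case \<open>N = 1\<close> also supplies the quotients \<open>f z / z\<close> and
  \<open>(b z - 1) / z\<close>.\<close>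

lemma power_series_remainder:
  fixes c :: "nat \<Rightarrow> complex"
  assumes "\<And>z. z \<in> ball 0 1 \<Longrightarrow> (\<lambda>n. c n * z ^ n) sums f z"
  shows "\<exists>g. g holomorphic_on ball 0 1 \<and>
    (\<forall>z \<in> ball 0 1. f z = (\<Sum>n<N. c n * z ^ n) + z ^ N * g z) \<and>
    (\<forall>z \<in> ball 0 1. (\<lambda>n. c (n + N) * z ^ n) sums g z)"
proof (intro exI conjI ballI)
  define g where "g = (\<lambda>z. \<Sum>n. c (n + N) * z ^ n)"
  have summ: "summable (\<lambda>n. c (n + N) * z ^ n)" if "z \<in> ball 0 1" for z
  proof (cases "z = 0")
    case False
    have "summable (\<lambda>n. c (n + N) * z ^ (n + N))"
      using assms[OF that] by (subst summable_iff_shift) (auto simp: sums_iff)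
    from summable_mult[OF this, of "inverse (z ^ N)"] False show ?thesis
      by (simp add: power_add field_simps)
  qed auto
  show "g holomorphic_on ball 0 1"
    by (rule power_series_holomorphic[of 0 1 "\<lambda>n. c (n + N)"])
       (use summ in \<open>auto simp: g_def intro!: summable_sums\<close>)
  show "(\<lambda>n. c (n + N) * z ^ n) sums g z" if "z \<in> ball 0 1" for z
    unfolding g_def by (rule summable_sums[OF summ[OF that]])
  show "f z = (\<Sum>n<N. c n * z ^ n) + z ^ N * g z" if z: "z \<in> ball 0 1" for z
  proof -
    have "f z = (\<Sum>n. c n * z ^ n)" "summable (\<lambda>n. c n * z ^ n)"
      using assms[OF z] by (auto simp: sums_iff)
    moreover have "z ^ N * g z = (\<Sum>n. c (n + N) * z ^ (n + N))"
      unfolding g_def using summ[OF z] by (subst suminf_mult[symmetric]) (auto simp: power_add mult_ac)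
    ultimately show ?thesis using suminf_split_initial_segment[of "\<lambda>n. c n * z ^ n" N] by simp
  qed
qed

section \<open>The area of the image of an annulus\<close>

text \<open>The left side will bound the corrected map on the circle of radius \<open>s\<close>.
  Right minus left is \<open>C^2 * \<rho>^2 * (1 - s)\<close> plus a multiple of
  \<open>(s - \<rho>) / s\<close>; the multiplier is nonnegative since \<open>1 / \<rho>\<close> is
  at least \<open>2 * C + 4 * M\<close> and \<open>s + \<rho> \<le> 2\<close>.\<close>

lemma outer_radius_bound:
  fixes s \<rho> C M :: real
  assumes "0 < \<rho>" "\<rho> \<le> s" "s \<le> 1" "C \<ge> 0" "M \<ge> 0" "\<rho> * (2 * C + 4 * M) \<le> 1"
  shows "1 / s + C * (s - \<rho>\<^sup>2 / s) + C\<^sup>2 * \<rho>\<^sup>2 * s + 2 * M * s\<^sup>2 \<le> 1 / \<rho> + (C\<^sup>2 + 2 * M) * \<rho>\<^sup>2"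
proof -
  have s: "s > 0" using assms by simp
  have "C * (s + \<rho>) \<le> C * 2" "2 * M * (s * (s + \<rho>)) \<le> 2 * M * (1 * 2)"
    using assms s by (intro mult_left_mono mult_mono; simp)+
  moreover have "2 * C + 4 * M \<le> 1 / \<rho>" using assms by (simp add: field_simps)
  ultimately have "0 \<le> 1 / \<rho> - C * (s + \<rho>) - 2 * M * (s * (s + \<rho>))" by linarith
  hence "0 \<le> (s - \<rho>) / s * (1 / \<rho> - C * (s + \<rho>) - 2 * M * (s * (s + \<rho>)))"
    using assms s by (intro mult_nonneg_nonneg) auto
  moreover have "0 \<le> C\<^sup>2 * \<rho>\<^sup>2 * (1 - s)" using assms by simp
  moreover have "1 / \<rho> + (C\<^sup>2 + 2 * M) * \<rho>\<^sup>2 - (1 / s + C * (s - \<rho>\<^sup>2 / s) + C\<^sup>2 * \<rho>\<^sup>2 * s + 2 * M * s\<^sup>2)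
     = (s - \<rho>) / s * (1 / \<rho> - C * (s + \<rho>) - 2 * M * (s * (s + \<rho>))) + C\<^sup>2 * \<rho>\<^sup>2 * (1 - s)"
    using s assms(1) by (simp add: field_simps power2_eq_square)
  ultimately show ?thesis by linarith
qed

text \<open>
  On \<open>|z| = \<rho>\<close> the map \<open>1 / z + c\<^sub>1 z\<close> traces an ellipse, whose area is too far below that of its
  circumscribed disc for the limit \<open>\<rho> \<rightarrow> 0\<close>. Applying \<open>w \<mapsto> w - c\<^sub>1 \<rho>\<^sup>2 cnj w\<close> first turns this
  ellipse into a circle, up to an error that vanishes with \<open>\<rho>\<close>.
\<close>

lemma annulus_area_inequality:
  fixes c :: "nat \<Rightarrow> complex" and \<phi> g k :: "complex \<Rightarrow> complex"
  assumes \<phi>: "\<phi> holomorphic_on ball 0 1"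
    and inj: "inj_on (\<lambda>z. 1 / z + \<phi> z) (ball 0 1 - {0})"
    and g: "g holomorphic_on ball 0 1" "\<And>z. z \<in> ball 0 1 \<Longrightarrow> \<phi> z = (\<Sum>n<N. c n * z ^ n) + z ^ N * g z"
    and k: "\<And>z. z \<in> ball 0 1 \<Longrightarrow> \<phi> z = c 0 + c 1 * z + z\<^sup>2 * k z"
    and M: "\<And>z. norm z < r \<Longrightarrow> norm (k z) \<le> M"
    and r: "0 < \<rho>" "\<rho> \<le> r" "r < 1" and small: "\<rho> * (2 * norm (c 1) + 4 * M) \<le> 1"
    "norm (c 1) * \<rho>\<^sup>2 \<le> 1"
  shows "(1 - (norm (c 1) * \<rho>\<^sup>2)\<^sup>2) * (1 / \<rho>\<^sup>2 - 1 / r\<^sup>2 + (\<Sum>n<N. n * norm (c n) ^ 2 * (r ^ (2 * n) - \<rho> ^ (2 * n))))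
     \<le> (1 / \<rho> + (norm (c 1) ^ 2 + 2 * M) * \<rho>\<^sup>2)\<^sup>2"
proof -
  define e where "e = c 1 * of_real (\<rho>\<^sup>2)"
  \<comment> \<open>In the coordinate \<open>exp z\<close> the annulus becomes a rectangle, so no polar coordinates are needed.\<close>
  define H where "H = (\<lambda>z. exp (-z) + \<phi> (exp z) - c 0)"
  define D where "D = (\<lambda>z. - exp (-z) + exp z * deriv \<phi> (exp z))"
  define K where "K = (\<lambda>z. H z - e * cnj (H z))"
  define R where "R = 1 / \<rho> + (norm (c 1) ^ 2 + 2 * M) * \<rho>\<^sup>2"
  let ?B = "box (Complex (ln \<rho>) 0) (Complex (ln r) (2*pi))"
  have M0: "M \<ge> 0" using order_trans[OF norm_ge_zero M[of 0]] r by simp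
  have R0: "R \<ge> 0" unfolding R_def using M0 r by (intro add_nonneg_nonneg) auto
  have e: "norm e = norm (c 1) * \<rho>\<^sup>2" unfolding e_def by (simp add: norm_mult norm_power)
  have B: "\<rho> < norm (exp z)" "norm (exp z) < r" if "z \<in> ?B" for z
  proof -
    have "ln \<rho> < Re z" "Re z < ln r" using that by (auto simp: in_box_complex_iff)
    hence "exp (ln \<rho>) < exp (Re z)" "exp (Re z) < exp (ln r)" by simp_all
    thus "\<rho> < norm (exp z)" "norm (exp z) < r" using r by simp_all
  qed
  have derH: "(H has_field_derivative D z) (at z)" if "norm (exp z) < 1" for z
  proof -
    have "(\<phi> has_field_derivative deriv \<phi> (exp z)) (at (exp z))"
      using that by (intro holomorphic_derivI[OF \<phi>]) auto
    from DERIV_chain2[OF this DERIV_exp] show ?thesis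
      unfolding H_def D_def by (auto intro!: derivative_eq_intros)
  qed
  have der: "(K has_derivative (\<lambda>h. D z * h - e * cnj (D z * h))) (at z)" if "z \<in> ?B" for z
  proof -
    have "(H has_derivative (\<lambda>h. D z * h)) (at z)"
      using derH[OF less_trans[OF B(2)[OF that] r(3)]] by (simp add: has_field_derivative_def)
    thus ?thesis unfolding K_def
      by (intro derivative_intros bounded_linear.has_derivative[OF bounded_linear_cnj])
  qed
  have injK: "inj_on K ?B"
  proof (rule inj_onI)
    fix z w assume zw: "z \<in> ?B" "w \<in> ?B" "K z = K w"
    let ?d = "H z - H w"
    have lt: "norm e < 1"
    proof (cases "norm (c 1) = 0")
      case False
      hence "norm (c 1) * \<rho>\<^sup>2 \<le> norm (c 1) * \<rho> * 1" using r by (simp add: power2_eq_square mult_left_le)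
      moreover have "\<rho> * (2 * norm (c 1)) \<le> \<rho> * (2 * norm (c 1) + 4 * M)" using r M0 by (intro mult_left_mono) auto
      ultimately show ?thesis unfolding e using small by (simp add: mult_ac)
    qed (simp add: e)
    \<comment> \<open>As \<open>|e| < 1\<close>, only 0 satisfies \<open>w = e * cnj w\<close>, so
      the real-linear correction preserves injectivity.\<close>
    have "?d = e * cnj ?d" using zw(3) by (simp add: K_def algebra_simps)
    hence "norm ?d = norm e * norm ?d" by (metis complex_mod_cnj norm_mult)
    hence "norm ?d = 0" using lt by (metis mult_cancel_right1 less_irrefl)
    hence "1 / exp z + \<phi> (exp z) = 1 / exp w + \<phi> (exp w)" by (simp add: H_def exp_minus field_simps)
    hence "exp z = exp w"
    proof (rule inj_onD[OF inj])
      show "exp z \<in> ball 0 1 - {0}" "exp w \<in> ball 0 1 - {0}"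
        using less_trans[OF B(2)[OF zw(1)] r(3)] less_trans[OF B(2)[OF zw(2)] r(3)]
        by (simp_all only: Diff_iff mem_ball dist_0_norm singleton_iff exp_not_eq_zero) auto
    qed
    then obtain n where n: "z = w + (of_int (2 * n) * pi) * \<i>" unfolding exp_eq by blast
    \<comment> \<open>The open rectangle has height \<open>2 * pi\<close>, which excludes a nonzero
      period of \<open>exp\<close>.\<close>
    have "\<bar>Im z - Im w\<bar> < 2 * pi" using zw by (auto simp: in_box_complex_iff)
    hence "\<bar>of_int n * (2 * pi)\<bar> < 1 * (2 * pi)" using n by (simp add: mult_ac)
    hence "\<bar>of_int n\<bar> < (1::real)" unfolding abs_mult by (simp add: abs_mult)
    thus "z = w" using n by simp
  qed
  have bd: "norm (K z) \<le> R" if "z \<in> ?B" for z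
  proof -
    define s where "s = norm (exp z)"
    have s: "\<rho> < s" "s < r" "0 < s" using B[OF that] r unfolding s_def by auto
    let ?u = "exp z"
    \<comment> \<open>Through this identity, \<open>e * cnj (exp (-z))\<close> is
      \<open>c 1 * exp z\<close> times \<open>\<rho>^2 / s^2\<close>. It cancels the linear term
      exactly on the inner circle.\<close>
    have cu: "cnj (exp (-z)) = ?u / of_real (s\<^sup>2)"
    proof -
      have "?u * cnj ?u = of_real (s\<^sup>2)" unfolding s_def by (simp add: complex_norm_square[symmetric])
      thus ?thesis using s by (simp add: exp_minus field_simps)
    qed
    have H: "H z = exp (-z) + c 1 * ?u + ?u\<^sup>2 * k ?u"
    proof -
      have "?u \<in> ball 0 1" using s r unfolding s_def by (simp only: mem_ball dist_0_norm)
      thus ?thesis unfolding H_def using k by simp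
    qed
    have "K z = exp (-z) + c 1 * ?u * of_real (1 - \<rho>\<^sup>2 / s\<^sup>2) - e * cnj (c 1 * ?u) + (?u\<^sup>2 * k ?u - e * cnj (?u\<^sup>2 * k ?u))"
      unfolding K_def H complex_cnj_add cu e_def by (simp add: algebra_simps)
    also have "norm \<dots> \<le> norm (exp (-z)) + norm (c 1 * ?u * of_real (1 - \<rho>\<^sup>2 / s\<^sup>2)) + norm (e * cnj (c 1 * ?u)) + (norm (?u\<^sup>2 * k ?u) + norm (e * cnj (?u\<^sup>2 * k ?u)))"
      by (intro norm_triangle_le norm_triangle_le_diff add_mono order.refl)
    also have "\<dots> = 1 / s + norm (c 1) * (s - \<rho>\<^sup>2 / s) + norm (c 1) ^ 2 * \<rho>\<^sup>2 * s + (1 + norm e) * s\<^sup>2 * norm (k ?u)"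
    proof -
      have "\<bar>1 - \<rho>\<^sup>2 / s\<^sup>2\<bar> = 1 - \<rho>\<^sup>2 / s\<^sup>2" using s r by (simp add: power_mono)
      hence "norm (of_real (1 - \<rho>\<^sup>2 / s\<^sup>2) :: complex) = 1 - \<rho>\<^sup>2 / s\<^sup>2" by (simp only: norm_of_real)
      moreover have "norm (exp (-z)) = 1 / s" unfolding s_def exp_minus norm_inverse by (simp add: field_simps)
      ultimately show ?thesis using s
        by (simp only: norm_mult complex_mod_cnj norm_power s_def[symmetric] e) (simp add: field_simps power2_eq_square)
    qed
    also have "(1 + norm e) * s\<^sup>2 * norm (k ?u) \<le> 2 * s\<^sup>2 * M"
      using small(2) s M[of ?u] M0 by (intro mult_mono) (auto simp: e s_def)
    also have "1 / s + norm (c 1) * (s - \<rho>\<^sup>2 / s) + norm (c 1) ^ 2 * \<rho>\<^sup>2 * s + 2 * s\<^sup>2 * M \<le> R"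
      using outer_radius_bound[of \<rho> s "norm (c 1)" M] s r small M0 unfolding R_def by (simp add: mult_ac)
    finally show ?thesis by simp
  qed
  have le1: "norm (exp z) < 1" if "Re z \<le> ln r" for z
  proof -
    have "exp (Re z) \<le> exp (ln r)" using that by simp
    hence "exp (Re z) \<le> r" using r by simp
    thus ?thesis using r(3) by (simp only: norm_exp_eq_Re)
  qed
  have contD: "continuous_on {z. Re z \<le> ln r} D"
  proof -
    have "continuous_on (ball 0 1) (deriv \<phi>)"
      by (intro holomorphic_on_imp_continuous_on holomorphic_deriv \<phi>) auto
    hence "continuous_on {z. Re z \<le> ln r} (\<lambda>z. deriv \<phi> (exp z))"
      by (rule continuous_on_compose2)
         (use le1 in \<open>auto intro!: continuous_intros simp del: norm_exp_eq_Re\<close>)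
    thus ?thesis unfolding D_def by (intro continuous_intros)
  qed
  have sub: "cbox (Complex (ln \<rho>) 0) (Complex (ln r) (2*pi)) \<subseteq> {z. Re z \<le> ln r}"
    by (auto simp: in_cbox_complex_iff)
  let ?I = "\<lambda>x. integral {0..2*pi} (\<lambda>y. norm (D (Complex x y)) ^ 2)"
  have area: "(1 - norm e ^ 2) * integral {ln \<rho>..ln r} ?I \<le> pi * R\<^sup>2"
    by (rule area_injective_image_le[OF der injK bd continuous_on_subset[OF contD sub]])
       (use small R0 in \<open>auto simp: e\<close>)
  \<comment> \<open>Multiplying \<open>D\<close> by \<open>exp z\<close> removes the pole: in
    \<open>u = exp z\<close> it becomes \<open>-1 + u^2 * deriv \<phi> u\<close>, with
    \<open>n * c n\<close> at \<open>u^(n+1)\<close>; hence the shift in \<open>d\<close>.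
    \<open>G\<close> collects what \<open>u\<close> times the derivative of \<open>u^N * g u\<close>
    leaves after the factor \<open>u^N\<close>.\<close>
  define d where "d = (\<lambda>j. case j of 0 \<Rightarrow> -1 | Suc n \<Rightarrow> of_nat n * c n)"
  define G where "G = (\<lambda>z. of_nat N * g z + z * deriv g z)"
  have G: "G holomorphic_on ball 0 1" unfolding G_def by (intro holomorphic_intros g) auto
  have zD: "exp z * D z = (\<Sum>j<Suc N. d j * exp z ^ j) + exp z ^ Suc N * G (exp z)" if "Re z \<le> ln r" for z
  proof -
    let ?u = "exp z"
    have u: "?u \<in> ball 0 1" using le1[OF that] by simp
    have "((\<lambda>z. (\<Sum>n<N. c n * z ^ n) + z ^ N * g z) has_field_derivative
       (\<Sum>n<N. c n * (of_nat n * ?u ^ (n - 1))) + (of_nat N * ?u ^ (N - 1) * g ?u + deriv g ?u * ?u ^ N)) (at ?u)"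
      using holomorphic_derivI[OF g(1) _ u]
      by (auto intro!: derivative_eq_intros simp: mult_ac)
    hence "(\<phi> has_field_derivative
       (\<Sum>n<N. c n * (of_nat n * ?u ^ (n - 1))) + (of_nat N * ?u ^ (N - 1) * g ?u + deriv g ?u * ?u ^ N)) (at ?u)"
      by (rule has_field_derivative_transform_within_open[of _ _ _ "ball 0 1"]) (use u g(2) in auto)
    hence d\<phi>: "deriv \<phi> ?u = (\<Sum>n<N. c n * (of_nat n * ?u ^ (n - 1))) + (of_nat N * ?u ^ (N - 1) * g ?u + deriv g ?u * ?u ^ N)"
      by (rule DERIV_imp_deriv)
    have pw: "of_nat n * ?u ^ (n - 1) * ?u = of_nat n * ?u ^ n" for n
      by (cases n) auto
    have "?u * deriv \<phi> ?u = (\<Sum>n<N. c n * (of_nat n * ?u ^ (n - 1) * ?u)) + (of_nat N * ?u ^ (N - 1) * ?u) * g ?u + deriv g ?u * ?u ^ N * ?u"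
      unfolding d\<phi> by (simp add: algebra_simps sum_distrib_left)
    also have "\<dots> = (\<Sum>n<N. of_nat n * c n * ?u ^ n) + ?u ^ N * G ?u"
      unfolding pw G_def by (simp add: algebra_simps)
    finally have "?u * D z = -1 + ?u * ((\<Sum>n<N. of_nat n * c n * ?u ^ n) + ?u ^ N * G ?u)"
      unfolding D_def by (simp add: exp_minus algebra_simps)
    thus ?thesis
      unfolding sum.lessThan_Suc_shift by (simp add: d_def sum_distrib_left algebra_simps)
  qed
  \<comment> \<open>\<open>2 * pi * S x\<close> is the truncated Parseval sum on the circle of
    radius \<open>exp x\<close>, divided by \<open>exp x ^ 2\<close> to undo the factor
    \<open>exp z\<close>.\<close>
  define S where "S = (\<lambda>x::real. exp (-2 * x) + (\<Sum>n<N. of_nat n ^ 2 * norm (c n) ^ 2 * exp (2 * n * x)))"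
  have lower: "2 * pi * S x \<le> ?I x" if "x \<in> {ln \<rho>..ln r}" for x
  proof -
    define t where "t = exp x"
    have "exp x \<le> exp (ln r)" using that by simp
    hence "t \<le> r" using r by (simp add: t_def)
    hence t: "0 < t" "t < 1" using r by (auto simp only: t_def exp_gt_zero)
    have ex: "exp (Complex x y) = of_real t * cis y" for y by (simp add: t_def exp_eq_polar)
    have "norm (D (Complex x y)) ^ 2 = norm ((\<Sum>j<Suc N. d j * (of_real t * cis y) ^ j) + (of_real t * cis y) ^ Suc N * G (of_real t * cis y)) ^ 2 * (1 / t\<^sup>2)" for y
    proof -
      have "norm (exp (Complex x y) * D (Complex x y)) ^ 2 = t\<^sup>2 * norm (D (Complex x y)) ^ 2"
        unfolding ex using t by (simp add: norm_mult power_mult_distrib)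
      thus ?thesis using t that unfolding zD[of "Complex x y"] ex[symmetric]
        by (subst (asm) zD) (auto simp: field_simps)
    qed
    hence "?I x = integral {0..2*pi} (\<lambda>y. norm ((\<Sum>j<Suc N. d j * (of_real t * cis y) ^ j) + (of_real t * cis y) ^ Suc N * G (of_real t * cis y)) ^ 2) * (1 / t\<^sup>2)"
      by (simp only: integral_mult_left)
    also have "\<dots> \<ge> 2 * pi * (\<Sum>j<Suc N. norm (d j) ^ 2 * t ^ (2 * j)) * (1 / t\<^sup>2)"
      by (intro mult_right_mono circle_bessel G t) auto
    also have "2 * pi * (\<Sum>j<Suc N. norm (d j) ^ 2 * t ^ (2 * j)) * (1 / t\<^sup>2) = 2 * pi * S x"
    proof -
      have 1: "exp (-2 * x) = 1 / t\<^sup>2" unfolding t_def by (simp add: exp_minus field_simps flip: exp_double)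
      have 2: "exp (2 * n * x) = t ^ (2 * n)" for n :: nat unfolding t_def exp_of_nat_mult[symmetric] by simp
      show ?thesis unfolding S_def 1 2 sum.lessThan_Suc_shift using t
        by (simp add: d_def norm_mult power_mult_distrib sum_distrib_left sum_distrib_right field_simps power2_eq_square)
    qed
    finally show ?thesis .
  qed
  have contI: "continuous_on {ln \<rho>..ln r} ?I"
  proof -
    have C: "Complex x y = of_real x + \<i> * of_real y" for x y by (simp add: complex_eq_iff)
    have "continuous_on ({ln \<rho>..ln r} \<times> cbox 0 (2*pi)) (\<lambda>(x, y). norm (D (Complex x y)) ^ 2)"
      unfolding case_prod_unfold C
      by (intro continuous_intros continuous_on_compose2[OF contD]) auto
    from integral_continuous_on_param[OF this] show ?thesis by simp
  qed
  define T where "T = (\<lambda>x::real. pi * (- exp (-2 * x) + (\<Sum>n<N. of_nat n * norm (c n) ^ 2 * exp (2 * n * x))))"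
  have "((\<lambda>x. 2 * pi * S x) has_integral (T (ln r) - T (ln \<rho>))) {ln \<rho>..ln r}"
  proof (rule fundamental_theorem_of_calculus)
    show "(T has_vector_derivative 2 * pi * S x) (at x within {ln \<rho>..ln r})" for x
      unfolding T_def S_def has_real_derivative_iff_has_vector_derivative[symmetric]
      by (auto intro!: derivative_eq_intros sum.cong simp: sum_distrib_left algebra_simps power2_eq_square)
  qed (use r in auto)
  hence "T (ln r) - T (ln \<rho>) \<le> integral {ln \<rho>..ln r} ?I"
    by (rule has_integral_le[OF _ integrable_integral[OF integrable_continuous_interval[OF contI]]]) (use lower in auto)
  moreover have "T (ln x) = pi * (- 1 / x\<^sup>2 + (\<Sum>n<N. of_nat n * norm (c n) ^ 2 * x ^ (2 * n)))" if "x > 0" for x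
  proof -
    have 1: "exp (-2 * ln x) = 1 / x\<^sup>2" 
      using that exp_minus[of "2 * ln x"] exp_double[of "ln x"] by (simp add: inverse_eq_divide)
    have 2: "exp (2 * n * ln x) = x ^ (2 * n)" for n :: nat
      using that exp_of_nat_mult[of "2 * n" "ln x"] by simp
    show ?thesis unfolding T_def 1 2 by simp
  qed
  ultimately have "pi * (1 / \<rho>\<^sup>2 - 1 / r\<^sup>2 + (\<Sum>n<N. n * norm (c n) ^ 2 * (r ^ (2 * n) - \<rho> ^ (2 * n)))) \<le> integral {ln \<rho>..ln r} ?I"
    using r by (simp add: algebra_simps sum_subtractf)
  moreover have "0 \<le> 1 - norm e ^ 2" using small(2) by (simp add: e power_le_one)
  ultimately have "(1 - norm e ^ 2) * (pi * (1 / \<rho>\<^sup>2 - 1 / r\<^sup>2 + (\<Sum>n<N. n * norm (c n) ^ 2 * (r ^ (2 * n) - \<rho> ^ (2 * n))))) \<le> pi * R\<^sup>2"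
    using area by (meson mult_left_mono order.trans)
  hence "pi * ((1 - norm e ^ 2) * (1 / \<rho>\<^sup>2 - 1 / r\<^sup>2 + (\<Sum>n<N. n * norm (c n) ^ 2 * (r ^ (2 * n) - \<rho> ^ (2 * n))))) \<le> pi * R\<^sup>2"
    by (simp only: mult.left_commute)
  thus ?thesis unfolding R_def e by (rule mult_left_le_imp_le) simp
qed

text \<open>Letting \<open>\<rho>\<close> tend to 0 in the annulus inequality cancels the two terms
  \<open>1 / \<rho>^2\<close> and bounds the weighted sum at radius \<open>r\<close> by
  \<open>1 / r^2\<close>; then \<open>r\<close> tends to 1.\<close>

theorem gronwall_area:
  fixes c :: "nat \<Rightarrow> complex"
  assumes \<phi>: "\<phi> holomorphic_on ball 0 1"
    and inj: "inj_on (\<lambda>z. 1 / z + \<phi> z) (ball 0 1 - {0})"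
    and sums: "\<And>z. z \<in> ball 0 1 \<Longrightarrow> (\<lambda>n. c n * z ^ n) sums \<phi> z"
  shows "(\<Sum>n<N. n * norm (c n) ^ 2) \<le> 1"
proof -
  obtain g where g: "g holomorphic_on ball 0 1" "\<And>z. z \<in> ball 0 1 \<Longrightarrow> \<phi> z = (\<Sum>n<N. c n * z ^ n) + z ^ N * g z"
    using power_series_remainder[OF sums, of N] by blast
  obtain k where k: "k holomorphic_on ball 0 1" "\<And>z. z \<in> ball 0 1 \<Longrightarrow> \<phi> z = (\<Sum>n<2. c n * z ^ n) + z ^ 2 * k z"
    using power_series_remainder[OF sums, of 2] by blast
  have k': "\<phi> z = c 0 + c 1 * z + z\<^sup>2 * k z" if "z \<in> ball 0 1" for z
    using k(2)[OF that] by (simp add: numeral_2_eq_2)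
  let ?S = "\<lambda>x::real. \<Sum>n<N. n * norm (c n) ^ 2 * x ^ (2 * n)"
  have *: "?S r \<le> 1 / r\<^sup>2" if r: "0 < r" "r < 1" for r
  proof -
    have "compact (k ` cball 0 r)"
      using r by (intro compact_continuous_image holomorphic_on_imp_continuous_on holomorphic_on_subset[OF k(1)]) auto
    then obtain M where M: "\<And>z. norm z \<le> r \<Longrightarrow> norm (k z) \<le> M"
      by (metis bounded_iff compact_imp_bounded image_eqI mem_cball_0)
    let ?C = "norm (c 1)"
    \<comment> \<open>These are the two sides without \<open>1 / \<rho>^2\<close>. The prefactor
      changes that term only by \<open>?C^2 * \<rho>^2\<close>, which moves into \<open>?R\<close>,
      so both sides have limits at 0.\<close>
    let ?L = "\<lambda>\<rho>. (1 - (?C * \<rho>\<^sup>2)\<^sup>2) * (?S r - 1 / r\<^sup>2 - ?S \<rho>)"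
    let ?R = "\<lambda>\<rho>. 2 * (?C\<^sup>2 + 2 * M) * \<rho> + (?C\<^sup>2 + 2 * M)\<^sup>2 * \<rho> ^ 4 + ?C\<^sup>2 * \<rho>\<^sup>2"
    have "((\<lambda>\<rho>. \<rho> * (2 * ?C + 4 * M)) \<longlongrightarrow> 0 * (2 * ?C + 4 * M)) (at_right 0)"
      by (intro tendsto_intros)
    hence "eventually (\<lambda>\<rho>. \<rho> * (2 * ?C + 4 * M) < 1) (at_right 0)"
      by (rule order_tendstoD) simp
    moreover have "((\<lambda>\<rho>. ?C * \<rho>\<^sup>2) \<longlongrightarrow> ?C * 0\<^sup>2) (at_right 0)"
      by (intro tendsto_intros)
    hence "eventually (\<lambda>\<rho>. ?C * \<rho>\<^sup>2 < 1) (at_right 0)"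
      by (rule order_tendstoD) simp
    moreover have "eventually (\<lambda>\<rho>. \<rho> \<in> {0<..<r}) (at_right 0)"
      using r(1) by (rule eventually_at_right_real)
    ultimately have ev: "eventually (\<lambda>\<rho>. ?L \<rho> \<le> ?R \<rho>) (at_right 0)"
    proof eventually_elim
      case (elim \<rho>)
      have "(1 - (?C * \<rho>\<^sup>2)\<^sup>2) * (1 / \<rho>\<^sup>2 - 1 / r\<^sup>2 + (\<Sum>n<N. n * norm (c n) ^ 2 * (r ^ (2 * n) - \<rho> ^ (2 * n))))
        \<le> (1 / \<rho> + (?C\<^sup>2 + 2 * M) * \<rho>\<^sup>2)\<^sup>2"
        by (rule annulus_area_inequality[OF \<phi> inj g k']) (use M elim r in auto)
      also have "(\<Sum>n<N. n * norm (c n) ^ 2 * (r ^ (2 * n) - \<rho> ^ (2 * n))) = ?S r - ?S \<rho>"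
        by (simp add: algebra_simps sum_subtractf)
      also have "(1 - (?C * \<rho>\<^sup>2)\<^sup>2) * (1 / \<rho>\<^sup>2 - 1 / r\<^sup>2 + (?S r - ?S \<rho>)) = ?L \<rho> + (1 / \<rho>\<^sup>2 - ?C\<^sup>2 * \<rho>\<^sup>2)"
        using elim by (simp add: field_simps power2_eq_square)
      also have "(1 / \<rho> + (?C\<^sup>2 + 2 * M) * \<rho>\<^sup>2)\<^sup>2 = 1 / \<rho>\<^sup>2 + 2 * (?C\<^sup>2 + 2 * M) * \<rho> + (?C\<^sup>2 + 2 * M)\<^sup>2 * \<rho> ^ 4"
        using elim by (simp add: field_simps power2_eq_square power4_eq_xxxx)
      finally show ?case by linarith
    qed
    \<comment> \<open>For \<open>n = 0\<close> the power is \<open>0 ^ 0 = 1\<close>, but the weight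
      \<open>n\<close> removes the term.\<close>
    have S0: "?S 0 = 0" by (intro sum.neutral) auto
    have L: "(?L \<longlongrightarrow> (1 - (?C * 0\<^sup>2)\<^sup>2) * (?S r - 1 / r\<^sup>2 - ?S 0)) (at_right 0)"
      by (intro tendsto_intros)
    have R: "(?R \<longlongrightarrow> 2 * (?C\<^sup>2 + 2 * M) * 0 + (?C\<^sup>2 + 2 * M)\<^sup>2 * 0 ^ 4 + ?C\<^sup>2 * 0\<^sup>2) (at_right 0)"
      by (intro tendsto_intros)
    have "(1 - (?C * 0\<^sup>2)\<^sup>2) * (?S r - 1 / r\<^sup>2 - ?S 0) \<le> 2 * (?C\<^sup>2 + 2 * M) * 0 + (?C\<^sup>2 + 2 * M)\<^sup>2 * 0 ^ 4 + ?C\<^sup>2 * 0\<^sup>2"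
      by (rule tendsto_le[OF _ R L ev]) simp
    thus ?thesis unfolding S0 by simp
  qed
  have "?S 1 \<le> 1 / 1\<^sup>2"
  proof (rule tendsto_le[of "at_left (1::real)"])
    show "eventually (\<lambda>r. ?S r \<le> 1 / r\<^sup>2) (at_left 1)"
      by (rule eventually_mono[OF eventually_at_left_real[of 0 "1::real"]]) (use * in auto)
    show "(?S \<longlongrightarrow> ?S 1) (at_left 1)" by (intro tendsto_intros)
    show "((\<lambda>r. 1 / r\<^sup>2) \<longlongrightarrow> 1 / 1\<^sup>2) (at_left (1::real))" by (intro tendsto_intros) simp
  qed simp
  thus ?thesis by simp
qed

section \<open>Root transforms of functions in class S\<close>

text \<open>The quotient \<open>f z / z\<close> has no zero in the disc, so it has a holomorphic
  logarithm and \<open>z / f z\<close> a holomorphic \<open>k\<close>-th root \<open>b\<close>. The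
  coefficient of \<open>z^m\<close> in \<open>b (z^k) / z - 1 / z\<close> is nonzero only if
  \<open>k\<close> divides \<open>m + 1\<close>, which accounts for the conditional.\<close>

lemma class_S_root_area:
  assumes f: "f \<in> class_S" and k: "k > 0"
  shows "\<exists>b \<beta>. (\<forall>z \<in> ball 0 1. (\<lambda>n. \<beta> n * z ^ n) sums b z) \<and>
    (\<forall>z \<in> ball 0 1. f z * b z ^ k = z) \<and> \<beta> 0 = 1 \<and>
    (\<forall>N. (\<Sum>m<N. m * norm (if k dvd Suc m then \<beta> (Suc m div k) else 0) ^ 2) \<le> 1)"
proof -
  have hol: "f holomorphic_on ball 0 1" and inj: "inj_on f (ball 0 1)" and f0: "f 0 = 0" and f1: "deriv f 0 = 1"
    using f by (auto simp: class_S_def)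
  obtain g where g: "g holomorphic_on ball 0 1"
      "\<And>z. z \<in> ball 0 1 \<Longrightarrow> f z = z * g z"
      "g 0 = 1"
  proof -
    have s: "(\<lambda>n. (deriv ^^ n) f 0 / fact n * z ^ n) sums f z" if "z \<in> ball 0 1" for z
      using holomorphic_power_series[OF hol that] by simp
    obtain g where g: "g holomorphic_on ball 0 1"
      "\<And>z. z \<in> ball 0 1 \<Longrightarrow> f z = (\<Sum>n<1. (deriv ^^ n) f 0 / fact n * z ^ n) + z ^ 1 * g z"
      "\<And>z. z \<in> ball 0 1 \<Longrightarrow> (\<lambda>n. (deriv ^^ (n + 1)) f 0 / fact (n + 1) * z ^ n) sums g z"
      using power_series_remainder[OF s, of 1] by blast
    show ?thesis
    proof (rule that[OF g(1)])
      show "f z = z * g z" if "z \<in> ball 0 1" for z using g(2)[OF that] f0 by simp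
      show "g 0 = 1" using sums_unique2[OF g(3)[of 0] powser_sums_zero] f1 by simp
    qed
  qed
  have g0: "g z \<noteq> 0" if "z \<in> ball 0 1" for z
  proof (cases "z = 0")
    case False
    hence "f z \<noteq> f 0" using inj that by (auto dest: inj_onD)
    thus ?thesis using g(2)[OF that] f0 by auto
  qed (simp add: g)
  obtain L where L: "L holomorphic_on ball 0 1" "\<And>z. z \<in> ball 0 1 \<Longrightarrow> g z = exp (L z)"
    
    using contractible_imp_holomorphic_log[OF g(1) convex_imp_contractible[OF convex_ball] g0] by blast
  \<comment> \<open>Subtracting \<open>L 0\<close> makes \<open>b 0 = 1\<close> for any branch of
    the logarithm; \<open>b^k\<close> is unaffected because
    \<open>exp (L 0) = g 0 = 1\<close>.\<close>
  define b where "b = (\<lambda>z. exp ((L 0 - L z) / of_nat k))"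
  have b: "b holomorphic_on ball 0 1" unfolding b_def using k by (intro holomorphic_intros L) auto
  have b0: "b 0 = 1" by (simp add: b_def)
  have bk: "f z * b z ^ k = z" if "z \<in> ball 0 1" for z
  proof -
    have "b z ^ k = exp (L 0 - L z)" unfolding b_def using k by (simp flip: exp_of_nat_mult)
    also have "\<dots> = g 0 / g z" using L(2)[OF that] L(2)[of 0] by (simp add: exp_diff)
    finally show ?thesis using g(2)[OF that] g0[OF that] g(3) by simp
  qed
  define \<beta> where "\<beta> = (\<lambda>n. (deriv ^^ n) b 0 / fact n)"
  have \<beta>: "(\<lambda>n. \<beta> n * z ^ n) sums b z" if "z \<in> ball 0 1" for z
    using holomorphic_power_series[OF b that] by (simp add: \<beta>_def)
  have \<beta>0: "\<beta> 0 = 1" by (simp add: \<beta>_def b0)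
  obtain q where q: "q holomorphic_on ball 0 1"
      "\<And>z. z \<in> ball 0 1 \<Longrightarrow> b z = (\<Sum>n<1. \<beta> n * z ^ n) + z ^ 1 * q z"
      "\<And>z. z \<in> ball 0 1 \<Longrightarrow> (\<lambda>n. \<beta> (n + 1) * z ^ n) sums q z"
    using power_series_remainder[OF \<beta>, of 1] by blast
  have zk: "z ^ k \<in> ball 0 1" if "z \<in> ball 0 1" for z :: complex
    using that k by (simp add: norm_power power_less_one_iff)
  define \<phi> where "\<phi> = (\<lambda>z. z ^ (k - 1) * q (z ^ k))"
  define c where "c = (\<lambda>m. if k dvd Suc m then \<beta> (Suc m div k) else 0)"
  have "(\<Sum>m<N. m * norm (c m) ^ 2) \<le> 1" for N
  proof (rule gronwall_area)
    have "(\<lambda>z::complex. z ^ k) holomorphic_on ball 0 1" by (intro holomorphic_intros)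
    hence "(\<lambda>z. q (z ^ k)) holomorphic_on ball 0 1"
      using holomorphic_on_compose_gen[OF _ q(1), of "\<lambda>z. z ^ k" "ball 0 1"] zk
      by (simp add: o_def image_subset_iff)
    thus "\<phi> holomorphic_on ball 0 1" unfolding \<phi>_def by (intro holomorphic_intros)
    show "(\<lambda>n. c n * z ^ n) sums \<phi> z" if z: "z \<in> ball 0 1" for z
    proof -
      \<comment> \<open>The exponents that actually occur are \<open>k * (n + 1) - 1\<close>; all
        other coefficients \<open>c\<close> vanish, so the series can be reindexed.\<close>
      define r where "r = (\<lambda>n. k * Suc n - 1)"
      have Sr: "Suc (r n) = k * Suc n" for n using k by (simp add: r_def)
      have mono: "strict_mono r" using k by (auto simp: strict_mono_Suc_iff r_def)
      have out: "c n * z ^ n = 0" if "n \<notin> range r" for n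
      proof -
        have "\<not> k dvd Suc n"
        proof
          assume "k dvd Suc n"
          then obtain j where j: "Suc n = k * j" by auto
          then obtain i where "j = Suc i" by (cases j) auto
          hence "n = r i" using j Sr[of i] by simp
          thus False using that by blast
        qed
        thus ?thesis by (simp add: c_def)
      qed
      have "(\<lambda>n. z ^ (k - 1) * (\<beta> (n + 1) * (z ^ k) ^ n)) sums (z ^ (k - 1) * q (z ^ k))"
        by (intro sums_mult q zk z)
      also have "(\<lambda>n. z ^ (k - 1) * (\<beta> (n + 1) * (z ^ k) ^ n)) = (\<lambda>n. c (r n) * z ^ r n)"
      proof
        fix n
        have "r n = (k - 1) + k * n" using k by (simp add: r_def)
        moreover have "c (r n) = \<beta> (Suc n)" unfolding c_def Sr using k by simp
        ultimately show "z ^ (k - 1) * (\<beta> (n + 1) * (z ^ k) ^ n) = c (r n) * z ^ r n"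
          by (simp add: power_add power_mult)
      qed
      finally show ?thesis unfolding \<phi>_def
        using sums_mono_reindex[OF mono, of "\<lambda>n. c n * z ^ n"] out by simp
    qed
    have h: "1 / z + \<phi> z = b (z ^ k) / z" if "z \<in> ball 0 1 - {0}" for z
    proof -
      have "z * z ^ (k - 1) = z ^ k" using k by (cases k) auto
      hence "z * \<phi> z = z ^ k * q (z ^ k)" by (simp add: \<phi>_def flip: mult.assoc)
      hence "b (z ^ k) = 1 + z * \<phi> z" using q(2)[OF zk, of z] that \<beta>0 by simp
      thus ?thesis using that by (simp add: field_simps)
    qed
    show "inj_on (\<lambda>z. 1 / z + \<phi> z) (ball 0 1 - {0})"
    proof (rule inj_onI)
      fix z w assume zw: "z \<in> ball 0 1 - {0}" "w \<in> ball 0 1 - {0}" "1 / z + \<phi> z = 1 / w + \<phi> w"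
      hence eq: "b (z ^ k) / z = b (w ^ k) / w" using h by simp
      \<comment> \<open>The \<open>k\<close>-th power of \<open>b (u^k) / u\<close> is
        \<open>1 / f (u^k)\<close>. Equal values thus give \<open>z^k = w^k\<close>, and cancelling
        the common nonzero value of \<open>b\<close> gives \<open>z = w\<close> itself.\<close>
      have fz: "f (u ^ k) * (b (u ^ k) / u) ^ k = 1" if "u \<in> ball 0 1 - {0}" for u
        using bk[OF zk[of u]] that by (simp add: power_divide)
      have "f (z ^ k) = f (w ^ k)"
        using fz[OF zw(1)] fz[OF zw(2)] unfolding eq by (metis mult_cancel_right zero_neq_one mult_zero_right)
      hence "z ^ k = w ^ k" using inj zk zw by (auto dest: inj_onD)
      moreover have "b (z ^ k) \<noteq> 0" by (simp add: b_def)
      ultimately show "z = w" using eq zw by (simp add: divide_eq_eq eq_divide_eq)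
    qed
  qed
  thus ?thesis using \<beta> bk \<beta>0 unfolding c_def by blast
qed

section \<open>Coefficients of roots and inverses\<close>

lemma has_fps_expansion_of_sums:
  fixes a :: "nat \<Rightarrow> complex"
  assumes "\<And>z. z \<in> ball 0 1 \<Longrightarrow> (\<lambda>n. a n * z ^ n) sums f z"
  shows "f has_fps_expansion Abs_fps a"
  by (rule has_fps_expansionI, rule eventually_mono[OF eventually_nhds_in_open[of "ball 0 1"]])
     (use assms in auto)

text \<open>As an identity of formal power series the relation can be compared coefficient by
  coefficient, by finite algebra.\<close>

lemma fps_root_relation:
  fixes a b :: "nat \<Rightarrow> complex"
  assumes "\<And>z. z \<in> ball 0 1 \<Longrightarrow> (\<lambda>n. a n * z ^ n) sums f z"
    and "\<And>z. z \<in> ball 0 1 \<Longrightarrow> (\<lambda>n. b n * z ^ n) sums h z"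
    and "\<And>z. z \<in> ball 0 1 \<Longrightarrow> f z * h z ^ k = z"
  shows "Abs_fps a * Abs_fps b ^ k = fps_X"
proof -
  have "(\<lambda>z. f z * h z ^ k) has_fps_expansion Abs_fps a * Abs_fps b ^ k"
    by (intro fps_expansion_intros has_fps_expansion_of_sums assms)
  moreover have "eventually (\<lambda>z. f z * h z ^ k = z) (nhds 0)"
    by (rule eventually_mono[OF eventually_nhds_in_open[of "ball 0 1"]]) (use assms(3) in auto)
  hence "(\<lambda>z. f z * h z ^ k) has_fps_expansion Abs_fps a * Abs_fps b ^ k \<longleftrightarrow>
      (\<lambda>z. z) has_fps_expansion Abs_fps a * Abs_fps b ^ k"
    by (rule has_fps_expansion_cong) simp
  ultimately show ?thesis using fps_expansion_unique_complex has_fps_expansion_fps_X by blast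
qed

text \<open>Since \<open>b 0 = 1\<close>, the coefficient of order \<open>n\<close> in the product
  is \<open>a n\<close> plus terms with earlier \<open>a i\<close>: the system is triangular and is
  solved upwards.\<close>

lemma sqrt_root_coeffs:
  fixes a b :: "nat \<Rightarrow> complex"
  assumes eq: "Abs_fps a * Abs_fps b ^ 2 = fps_X" and b0: "b 0 = 1"
  shows "a 2 = - 2 * b 1" "a 3 = 3 * b 1 ^ 2 - 2 * b 2"
    "a 4 = - 2 * b 3 + 6 * b 1 * b 2 - 4 * b 1 ^ 3"
    "a 5 = - 2 * b 4 + 6 * b 1 * b 3 + 3 * b 2 ^ 2 - 12 * b 1 ^ 2 * b 2 + 5 * b 1 ^ 4"
proof -
  have n: "(\<Sum>i=0..n. a i * (\<Sum>j=0..n-i. b j * b (n - i - j))) = (if n = 1 then 1 else 0)" for n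
    using arg_cong[OF eq, of "\<lambda>F. fps_nth F n"] by (simp add: fps_mult_nth power2_eq_square)
  note S = sum.atLeast0_atMost_Suc numeral_eq_Suc b0
  have a0: "a 0 = 0" using n[of 0] by (simp add: S)
  have a1: "a (Suc 0) = 1" using n[of 1] by (simp add: S a0)
  have 2: "a 2 + 2 * b 1 = 0" using n[of 2] by (simp add: S a0 a1 algebra_simps)
  have 3: "a 3 + a 2 * (2 * b 1) + (2 * b 2 + b 1 ^ 2) = 0"
    using n[of 3] by (simp add: S a0 a1 algebra_simps)
  have 4: "a 4 + a 3 * (2 * b 1) + a 2 * (2 * b 2 + b 1 ^ 2) + (2 * b 3 + 2 * b 1 * b 2) = 0"
    using n[of 4] by (simp add: S a0 a1 algebra_simps)
  have 5: "a 5 + a 4 * (2 * b 1) + a 3 * (2 * b 2 + b 1 ^ 2) + a 2 * (2 * b 3 + 2 * b 1 * b 2) + (2 * b 4 + 2 * b 1 * b 3 + b 2 ^ 2) = 0"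
    using n[of 5] by (simp add: S a0 a1 algebra_simps)
  show a2: "a 2 = - 2 * b 1" using 2 by algebra
  show a3: "a 3 = 3 * b 1 ^ 2 - 2 * b 2" using 3 unfolding a2 by algebra
  show a4: "a 4 = - 2 * b 3 + 6 * b 1 * b 2 - 4 * b 1 ^ 3" using 4 unfolding a2 a3 by algebra
  show "a 5 = - 2 * b 4 + 6 * b 1 * b 3 + 3 * b 2 ^ 2 - 12 * b 1 ^ 2 * b 2 + 5 * b 1 ^ 4"
    using 5 unfolding a2 a3 a4 by algebra
qed

lemma cube_root_coeffs:
  fixes a p :: "nat \<Rightarrow> complex"
  assumes eq: "Abs_fps a * Abs_fps p ^ 3 = fps_X" and p0: "p 0 = 1"
  shows "a 2 = - 3 * p 1" "a 3 = 6 * p 1 ^ 2 - 3 * p 2"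
    "a 4 = - 3 * p 3 + 12 * p 1 * p 2 - 10 * p 1 ^ 3"
proof -
  have n: "(\<Sum>i=0..n. a i * (\<Sum>j=0..n-i. p j * (\<Sum>l=0..n-i-j. p l * p (n - i - j - l)))) = (if n = 1 then 1 else 0)" for n
    using arg_cong[OF eq, of "\<lambda>F. fps_nth F n"] by (simp add: fps_mult_nth power3_eq_cube mult.assoc)
  note S = sum.atLeast0_atMost_Suc numeral_eq_Suc p0
  have a0: "a 0 = 0" using n[of 0] by (simp add: S)
  have a1: "a (Suc 0) = 1" using n[of 1] by (simp add: S a0)
  have 2: "a 2 + 3 * p 1 = 0" using n[of 2] by (simp add: S a0 a1 algebra_simps)
  have 3: "a 3 + a 2 * (3 * p 1) + (3 * p 2 + 3 * p 1 ^ 2) = 0"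
    using n[of 3] by (simp add: S a0 a1 algebra_simps)
  have 4: "a 4 + a 3 * (3 * p 1) + a 2 * (3 * p 2 + 3 * p 1 ^ 2) + (3 * p 3 + 6 * p 1 * p 2 + p 1 ^ 3) = 0"
    using n[of 4] by (simp add: S a0 a1 algebra_simps)
  show a2: "a 2 = - 3 * p 1" using 2 by algebra
  show a3: "a 3 = 6 * p 1 ^ 2 - 3 * p 2" using 3 unfolding a2 by algebra
  show a4: "a 4 = - 3 * p 3 + 12 * p 1 * p 2 - 10 * p 1 ^ 3" using 4 unfolding a2 a3 by algebra
qed

text \<open>Near 0 the composition of \<open>g\<close> with \<open>f\<close> is the identity, so the
  composed formal series is \<open>fps_X\<close>; its orders 0 and 1 normalise \<open>g\<close>, and
  orders 2 and 3 give the two formulas.\<close>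

lemma class_Sb_inverse:
  assumes f: "f \<in> class_Sb" and a: "\<And>z. z \<in> ball 0 1 \<Longrightarrow> (\<lambda>n. a n * z ^ n) sums f z"
  shows "\<exists>g A. g \<in> class_S \<and> (\<forall>z \<in> ball 0 1. (\<lambda>n. A n * z ^ n) sums g z) \<and>
    A 2 = - a 2 \<and> A 3 = 2 * a 2 ^ 2 - a 3"
proof -
  have fS: "f holomorphic_on ball 0 1" "inj_on f (ball 0 1)" "f 0 = 0" "deriv f 0 = 1"
    using f by (auto simp: class_Sb_def class_S_def)
  obtain g where g: "g holomorphic_on ball 0 1" "inj_on g (ball 0 1)"
      "eventually (\<lambda>w. g w = inv_into (ball 0 1) f w) (nhds 0)"
    using f by (auto simp: class_Sb_def)
  define A where "A = (\<lambda>n. (deriv ^^ n) g 0 / fact n)"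
  have A: "(\<lambda>n. A n * z ^ n) sums g z" if "z \<in> ball 0 1" for z
    using holomorphic_power_series[OF g(1) that] by (simp add: A_def)
  have exf: "f has_fps_expansion Abs_fps a" and exg: "g has_fps_expansion Abs_fps A"
    using a A by (auto intro!: has_fps_expansion_of_sums)
  have a0: "a 0 = 0" using has_fps_expansion_imp_0_eq_fps_nth_0[OF exf] fS(3) by simp
  have a1: "a (Suc 0) = 1" using fps_nth_fps_expansion[OF exf, of 1] fS(4) by simp
  have "isCont f 0"
    using holomorphic_on_imp_continuous_on[OF fS(1)] by (simp add: continuous_on_eq_continuous_at)
  hence "filterlim f (nhds 0) (nhds 0)" using fS(3) by (simp add: isCont_def tendsto_nhds_iff)
  hence "eventually (\<lambda>z. g (f z) = inv_into (ball 0 1) f (f z)) (nhds 0)"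
    by (rule eventually_compose_filterlim[OF g(3)])
  moreover have "eventually (\<lambda>z::complex. z \<in> ball 0 1) (nhds 0)"
    by (intro eventually_nhds_in_open) auto
  ultimately have ev: "eventually (\<lambda>z. (g \<circ> f) z = z) (nhds 0)"
    by eventually_elim (simp add: inv_into_f_f[OF fS(2)])
  have "(g \<circ> f) has_fps_expansion fps_compose (Abs_fps A) (Abs_fps a)"
    by (rule has_fps_expansion_compose[OF exg exf]) (simp add: a0)
  moreover have "(g \<circ> f) has_fps_expansion fps_compose (Abs_fps A) (Abs_fps a) \<longleftrightarrow>
      (\<lambda>z. z) has_fps_expansion fps_compose (Abs_fps A) (Abs_fps a)"
    by (rule has_fps_expansion_cong[OF ev]) simp
  ultimately have comp: "fps_compose (Abs_fps A) (Abs_fps a) = fps_X"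
    using fps_expansion_unique_complex has_fps_expansion_fps_X by blast
  have n: "(\<Sum>i=0..n. A i * fps_nth (Abs_fps a ^ i) n) = (if n = 1 then 1 else 0)" for n
    using arg_cong[OF comp, of "\<lambda>F. fps_nth F n"] by (simp add: fps_compose_nth)
  note S = sum.atLeast0_atMost_Suc numeral_eq_Suc fps_mult_nth a0 a1
  have A0: "A 0 = 0" using n[of 0] by (simp add: S)
  have A1: "A (Suc 0) = 1" using n[of 1] by (simp add: S A0)
  have A2: "A 2 = - a 2" using n[of 2] by (simp add: S A0 A1 add_eq_0_iff)
  have "A 3 + A 2 * (2 * a 2) + a 3 = 0" using n[of 3] by (simp add: S A0 A1 algebra_simps)
  hence A3: "A 3 = 2 * a 2 ^ 2 - a 3" unfolding A2 by algebra
  have "g \<in> class_S"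
    using g A0 A1 by (simp add: class_S_def A_def)
  thus ?thesis using A A2 A3 by blast
qed

section \<open>Coefficient inequalities\<close>

text \<open>Write \<open>x^2\<close> as \<open>(x^2 + y) - y\<close>, where both squared moduli are
  at most \<open>(1 - t) / 3\<close> with \<open>t = |x|^2\<close>. Then
  \<open>3 * t^2 \<le> 4 * (1 - t)\<close>, which factors.\<close>

lemma second_coeff_bound:
  fixes x y :: complex
  assumes A: "norm x ^ 2 + 3 * norm y ^ 2 \<le> 1" and C: "norm x ^ 2 + 3 * norm (x\<^sup>2 + y) ^ 2 \<le> 1"
  shows "norm x ^ 2 \<le> 2 / 3"
proof -
  let ?t = "norm x ^ 2"
  have "?t = norm ((x\<^sup>2 + y) - y)" by (simp add: norm_power)
  also have "\<dots> \<le> norm (x\<^sup>2 + y) + norm y" by (rule norm_triangle_ineq4)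
  finally have "?t \<le> norm (x\<^sup>2 + y) + norm y" .
  hence "?t ^ 2 \<le> (norm (x\<^sup>2 + y) + norm y) ^ 2" by (intro power_mono) auto
  also have "\<dots> \<le> 2 * norm (x\<^sup>2 + y) ^ 2 + 2 * norm y ^ 2"
    using zero_le_power2[of "norm (x\<^sup>2 + y) - norm y"] by (simp add: power2_eq_square algebra_simps)
  finally have "3 * ?t ^ 2 \<le> 4 - 4 * ?t" using A C by linarith
  hence "(3 * ?t - 2) * (?t + 2) \<le> 0" by (simp add: power2_eq_square algebra_simps)
  moreover have "?t + 2 > 0" by (simp add: add_nonneg_pos)
  ultimately show ?thesis by (simp add: mult_le_0_iff)
qed

section \<open>Differences of moduli of consecutive coefficients\<close>

lemma norm_diff_le_norm_add_mult:
  fixes u v \<kappa> :: complex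
  assumes "norm \<kappa> \<le> 1"
  shows "norm u - norm v \<le> norm (u + \<kappa> * v)"
proof -
  have "norm (\<kappa> * v) \<le> norm v" using assms by (simp add: norm_mult mult_left_le_one_le)
  moreover have "norm u \<le> norm (u + \<kappa> * v) + norm (\<kappa> * v)"
    using norm_triangle_ineq4[of "u + \<kappa> * v" "\<kappa> * v"] by simp
  ultimately show ?thesis by linarith
qed

text \<open>The multiplier \<open>4 / 3 * x\<close> cancels the terms in \<open>x ^ 3\<close>.\<close>

lemma fourth_minus_third_small:
  fixes x y w :: complex
  assumes A: "norm x ^ 2 + 3 * norm y ^ 2 + 5 * norm w ^ 2 \<le> 1" and x: "norm x \<le> 3 / 4"
  shows "norm (- 2 * w + 6 * x * y - 4 * x ^ 3) - norm (3 * x ^ 2 - 2 * y) \<le> 1.1749"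
proof -
  let ?t = "norm x ^ 2"
  have "norm (- 2 * w + 6 * x * y - 4 * x ^ 3) - norm (3 * x ^ 2 - 2 * y)
     \<le> norm (- 2 * w + 6 * x * y - 4 * x ^ 3 + (4 / 3 * x) * (3 * x ^ 2 - 2 * y))"
    using x by (intro norm_diff_le_norm_add_mult) (simp add: norm_mult)
  also have "- 2 * w + 6 * x * y - 4 * x ^ 3 + (4 / 3 * x) * (3 * x ^ 2 - 2 * y) = 10 / 3 * x * y - 2 * w"
    by (simp add: field_simps power2_eq_square power3_eq_cube)
  also have "norm \<dots> \<le> norm (10 / 3 * x * y) + norm (2 * w)" by (rule norm_triangle_ineq4)
  also have "\<dots> = 10 / 3 * norm x * norm y + 2 * norm w" by (simp add: norm_mult)
  finally have le: "norm (- 2 * w + 6 * x * y - 4 * x ^ 3) - norm (3 * x ^ 2 - 2 * y) \<le> 10 / 3 * norm x * norm y + 2 * norm w" .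
  \<comment> \<open>Cauchy-Schwarz with the weights 3 and 5 of \<open>A\<close>; the defect is one
    fifteenth of the square supplied.\<close>
  have "(10 / 3 * norm x * norm y + 2 * norm w)\<^sup>2 \<le> (100 / 27 * ?t + 4 / 5) * (3 * norm y ^ 2 + 5 * norm w ^ 2)"
    using zero_le_power2[of "50 / 3 * norm x * norm w - 6 * norm y"] by (simp add: power2_eq_square field_simps)
  also have "\<dots> \<le> (100 / 27 * ?t + 4 / 5) * (1 - ?t)"
    using A by (intro mult_left_mono) auto
  \<comment> \<open>The quadratic in \<open>|x|^2\<close> peaks at 0.392.\<close>
  also have "\<dots> \<le> 1.1749\<^sup>2"
    using zero_le_power2[of "?t - 0.392"] by (simp add: power2_eq_square field_simps)
  finally have "10 / 3 * norm x * norm y + 2 * norm w \<le> 1.1749" by (rule power2_le_imp_le) simp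
  with le show ?thesis by linarith
qed


text \<open>The number \<open>1633 / 2000\<close> lies just above \<open>sqrt (2 / 3)\<close>. The
  two terms are estimated separately: \<open>c^2\<close> is replaced by its chord over the interval
  where it must be bounded above, and by tangents at 0.78 and 0.79 where it must be bounded
  below.\<close>

lemma fourth_minus_third_polynomial_bound:
  fixes c :: real
  assumes c: "3 / 4 \<le> c" "c \<le> 1633 / 2000"
  defines "\<alpha> \<equiv> 8 * c - 3" and "d \<equiv> 8 / 3 - 80 * c / 27"
  shows "(9 / 8 + \<alpha>\<^sup>2 / 5) * (1 - 8 * c\<^sup>2 / 9) - c ^ 4 * (d * (0.6 * \<alpha> - d)) \<le> 1.1749\<^sup>2"
proof -
  have ch: "0 \<le> (c - 3 / 4) * (1633 / 2000 - c)" using c by (intro mult_nonneg_nonneg) auto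
  have "\<alpha>\<^sup>2 = 64 * c\<^sup>2 - 48 * c + 9"
    by (simp add: \<alpha>_def power2_eq_square algebra_simps)
  moreover have "c\<^sup>2 \<le> 3133 / 2000 * c - 4899 / 8000"
    using ch by (simp add: power2_eq_square field_simps)
  ultimately have "\<alpha>\<^sup>2 \<le> 64 * (3133 / 2000 * c - 4899 / 8000) - 48 * c + 9"
    by argo
  moreover have "1 - 8 * c\<^sup>2 / 9 \<le> 1 - 8 / 9 * (1.56 * c - 0.6084)"
    using zero_le_power2[of "c - 0.78"] by (simp add: power2_eq_square algebra_simps)
  moreover have "c\<^sup>2 \<le> (1633 / 2000)\<^sup>2" using c by (intro power_mono) auto
  ultimately have "(9 / 8 + \<alpha>\<^sup>2 / 5) * (1 - 8 * c\<^sup>2 / 9) \<le>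
      (9 / 8 + (64 * (3133 / 2000 * c - 4899 / 8000) - 48 * c + 9) / 5) * (1 - 8 / 9 * (1.56 * c - 0.6084))"
    using c by (intro mult_mono) (auto simp: power2_eq_square)
  also have "\<dots> = 2291645696 / 100000000 * c - 757056672 / 100000000 - 10869248 / 750000 * c\<^sup>2"
    by (simp add: power2_eq_square field_simps)
  also have "79 / 50 * c - 6241 / 10000 \<le> c\<^sup>2"
    using zero_le_power2[of "c - 79 / 100"] by (simp add: power2_eq_square field_simps)
  hence "2291645696 / 100000000 * c - 757056672 / 100000000 - 10869248 / 750000 * c\<^sup>2 \<le> 299 / 200"
    using c by argo
  finally have 1: "(9 / 8 + \<alpha>\<^sup>2 / 5) * (1 - 8 * c\<^sup>2 / 9) \<le> 299 / 200" .
  \<comment> \<open>A concave quadratic in \<open>c\<close>, so the endpoints decide; the smaller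
    value, about 0.463, is at \<open>1633 / 2000\<close>.\<close>
  have "0.46 \<le> d * (0.6 * \<alpha> - d)"
    using ch c by (simp add: \<alpha>_def d_def power2_eq_square field_simps)
  moreover have "(3 / 4) ^ 4 \<le> c ^ 4" using c by (intro power_mono) auto
  ultimately have "(3 / 4) ^ 4 * 0.46 \<le> c ^ 4 * (d * (0.6 * \<alpha> - d))" by (intro mult_mono) auto
  with 1 show ?thesis by (simp add: power2_eq_square eval_nat_numeral)
qed

text \<open>
  Here \<open>p2\<close>, \<open>p3\<close> are coefficients of the cube root of \<open>z / f\<close>, whose first coefficient is \<open>2 / 3 * x\<close>;
  in these terms \<open>y = 3 / 2 * p2 + x\<^sup>2 / 6\<close>. The inverse inequality \<open>C\<close> forces \<open>- p2 / x\<^sup>2\<close> to have real part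
  at least \<open>0.3\<close>; without this sign information the triangle inequality loses too much.
\<close>

lemma fourth_minus_third_large:
  fixes x p2 p3 :: complex
  assumes x: "3 / 4 \<le> norm x" "norm x ^ 2 \<le> 2 / 3"
    and B: "8 / 9 * norm x ^ 2 + 5 * norm p2 ^ 2 + 8 * norm p3 ^ 2 \<le> 1"
    and C: "norm x ^ 2 + 3 * norm (x\<^sup>2 + (3 / 2 * p2 + x\<^sup>2 / 6)) ^ 2 \<le> 1"
  shows "norm (- 3 * p3 + 8 * x * p2 - 80 / 27 * x ^ 3) - norm (8 / 3 * x\<^sup>2 - 3 * p2) \<le> 1.1749"
proof -
  define c where "c = norm x"
  define q where "q = - p2 / x\<^sup>2"
  \<comment> \<open>Dividing out powers of \<open>x\<close> leaves
    \<open>c * (8 * q + 80 / 27)\<close> from the fourth coefficient and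
    \<open>3 * q + 8 / 3\<close> from the third. Their difference is
    \<open>\<alpha> * q - d\<close>, which corresponds to the multiplier
    \<open>x / |x|\<close>.\<close>
  define \<alpha> where "\<alpha> = 8 * c - 3"
  define d where "d = 8 / 3 - 80 * c / 27"
  have x0: "x \<noteq> 0" using x by auto
  have p2: "p2 = - x\<^sup>2 * q" using x0 by (simp add: q_def)
  have c: "3 / 4 \<le> c" "c \<le> 1633 / 2000"
  proof -
    have "c\<^sup>2 \<le> (1633 / 2000)\<^sup>2" using x(2) by (simp add: c_def power2_eq_square)
    thus "c \<le> 1633 / 2000" by (rule power2_le_imp_le) simp
  qed (use x in \<open>simp add: c_def\<close>)
  have \<alpha>: "3 \<le> \<alpha>" and d: "0 \<le> d" "d \<le> 4 / 9" using c by (auto simp: \<alpha>_def d_def)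
  \<comment> \<open>Otherwise \<open>C\<close> fails at \<open>|x| \<ge> 3 / 4\<close>: its left
    side would be at least \<open>9 / 16 + 3 * (9 / 16 * 0.71)^2 > 1\<close>.\<close>
  have "0.3 \<le> Re q"
  proof (rule ccontr)
    assume "\<not> 0.3 \<le> Re q"
    hence "0.71 \<le> Re (7 / 6 - 3 / 2 * q)" by simp
    hence "0.71 \<le> norm (7 / 6 - 3 / 2 * q)" using complex_Re_le_cmod order_trans by blast
    hence "(9 / 16 * 0.71)\<^sup>2 \<le> (c\<^sup>2 * norm (7 / 6 - 3 / 2 * q))\<^sup>2"
      using power_mono[OF c(1), of 2] by (intro power_mono mult_mono) (auto simp: power2_eq_square)
    moreover have "x\<^sup>2 + (3 / 2 * p2 + x\<^sup>2 / 6) = x\<^sup>2 * (7 / 6 - 3 / 2 * q)"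
      unfolding p2 by (simp add: field_simps)
    hence "norm (x\<^sup>2 + (3 / 2 * p2 + x\<^sup>2 / 6)) = c\<^sup>2 * norm (7 / 6 - 3 / 2 * q)"
      by (simp only: norm_mult norm_power c_def)
    moreover have "(3 / 4)\<^sup>2 \<le> c\<^sup>2" using c by (intro power_mono) auto
    ultimately show False using C by (simp add: c_def power2_eq_square)
  qed
  hence "0.6 * \<alpha> - d \<le> 2 * \<alpha> * Re q - d"
    using mult_left_mono[of "0.3" "Re q" "2 * \<alpha>"] \<alpha> by simp
  hence Z: "d * (0.6 * \<alpha> - d) \<le> d * (2 * \<alpha> * Re q - d)"
    using d(1) by (rule mult_left_mono)
  have Z0: "0 \<le> d * (0.6 * \<alpha> - d)" using d \<alpha> by (intro mult_nonneg_nonneg) auto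
  define m where "m = c\<^sup>2 * norm (of_real \<alpha> * q - of_real d)"
  define P where "P = norm p2"
  have P: "P = c\<^sup>2 * norm q" by (simp add: P_def p2 norm_mult norm_power c_def)
  have "norm (of_real \<alpha> * q - of_real d) ^ 2 = \<alpha>\<^sup>2 * norm q ^ 2 - d * (2 * \<alpha> * Re q - d)"
    unfolding cmod_power2 by (simp add: power2_eq_square algebra_simps)
  then have m2: "m\<^sup>2 = \<alpha>\<^sup>2 * P\<^sup>2 - c ^ 4 * (d * (2 * \<alpha> * Re q - d))"
  proof -
    note h = \<open>norm (of_real \<alpha> * q - of_real d) ^ 2 = \<alpha>\<^sup>2 * norm q ^ 2 - d * (2 * \<alpha> * Re q - d)\<close>
    have "m\<^sup>2 = c ^ 4 * norm (of_real \<alpha> * q - of_real d) ^ 2" by (simp add: m_def power_mult_distrib)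
    thus ?thesis unfolding h P by (simp add: algebra_simps power_mult_distrib)
  qed
  have Z': "c ^ 4 * (d * (0.6 * \<alpha> - d)) \<le> c ^ 4 * (d * (2 * \<alpha> * Re q - d))"
    using Z by (rule mult_left_mono) simp
  moreover have Z0': "0 \<le> c ^ 4 * (d * (0.6 * \<alpha> - d))" using Z0 by simp
  ultimately have "m\<^sup>2 \<le> (\<alpha> * P)\<^sup>2" using m2 by (simp add: power_mult_distrib)
  hence m: "m \<le> \<alpha> * P" by (rule power2_le_imp_le) (use \<alpha> in \<open>simp add: P_def\<close>)
  \<comment> \<open>Cauchy-Schwarz with the weights 5 and 8 of \<open>B\<close>. Only the cross term
    uses \<open>m \<le> \<alpha> * P\<close>, so the negative part of \<open>m^2\<close> is kept as
    a gain.\<close>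
  have "6 * norm p3 * m \<le> 6 * norm p3 * (\<alpha> * P)" by (intro mult_left_mono m) simp
  also have "\<dots> \<le> 45 / 8 * P\<^sup>2 + 8 / 5 * \<alpha>\<^sup>2 * norm p3 ^ 2"
    using zero_le_power2[of "15 * P - 8 * \<alpha> * norm p3"] by (simp add: power2_eq_square field_simps)
  finally have "(3 * norm p3 + m)\<^sup>2 \<le> (9 / 8 + \<alpha>\<^sup>2 / 5) * (5 * P\<^sup>2 + 8 * norm p3 ^ 2) - c ^ 4 * (d * (0.6 * \<alpha> - d))"
    using m2 Z' by (simp add: power2_eq_square algebra_simps)
  also have "\<dots> \<le> (9 / 8 + \<alpha>\<^sup>2 / 5) * (1 - 8 * c\<^sup>2 / 9) - c ^ 4 * (d * (0.6 * \<alpha> - d))"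
    using B by (intro diff_right_mono mult_left_mono) (auto simp: P_def c_def)
  also have "\<dots> \<le> 1.1749\<^sup>2"
    unfolding \<alpha>_def d_def by (rule fourth_minus_third_polynomial_bound[OF c])
  finally have "3 * norm p3 + m \<le> 1.1749" by (rule power2_le_imp_le) simp
  moreover have "norm (- 3 * p3 + 8 * x * p2 - 80 / 27 * x ^ 3) \<le> 3 * norm p3 + c\<^sup>2 * (c * norm (8 * q + 80 / 27))"
  proof -
    have "- 3 * p3 + 8 * x * p2 - 80 / 27 * x ^ 3 = - 3 * p3 - x ^ 3 * (8 * q + 80 / 27)"
      unfolding p2 by (simp add: algebra_simps power2_eq_square power3_eq_cube)
    also have "norm \<dots> \<le> norm (- 3 * p3) + norm (x ^ 3 * (8 * q + 80 / 27))" by (rule norm_triangle_ineq4)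
    also have "\<dots> = 3 * norm p3 + c\<^sup>2 * (c * norm (8 * q + 80 / 27))"
      by (simp add: norm_mult norm_power c_def power2_eq_square power3_eq_cube)
    finally show ?thesis .
  qed
  moreover have "c * norm (8 * q + 80 / 27) \<le> norm (3 * q + 8 / 3) + norm (of_real \<alpha> * q - of_real d)"
  proof -
    have "c * norm (8 * q + 80 / 27) = norm (of_real c * (8 * q + 80 / 27))"
      using c by (simp add: norm_mult)
    also have "of_real c * (8 * q + 80 / 27) = (3 * q + 8 / 3) + (of_real \<alpha> * q - of_real d)"
      by (simp add: \<alpha>_def d_def algebra_simps)
    finally show ?thesis using norm_triangle_ineq by metis
  qed
  hence "c\<^sup>2 * (c * norm (8 * q + 80 / 27)) \<le> c\<^sup>2 * (norm (3 * q + 8 / 3) + norm (of_real \<alpha> * q - of_real d))"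
    by (intro mult_left_mono) auto
  moreover have "norm (8 / 3 * x\<^sup>2 - 3 * p2) = c\<^sup>2 * norm (3 * q + 8 / 3)"
  proof -
    have "8 / 3 * x\<^sup>2 - 3 * p2 = x\<^sup>2 * (3 * q + 8 / 3)" unfolding p2 by (simp add: algebra_simps)
    thus ?thesis by (simp only: norm_mult norm_power c_def)
  qed
  ultimately show ?thesis by (simp add: m_def algebra_simps)
qed

text \<open>\<open>m / 2\<close> acts as a Lagrange multiplier for \<open>A\<close>: it absorbs
  \<open>v\<close> and \<open>w\<close>, leaving a function of \<open>t = c^2\<close> and a multiple
  of \<open>y^2\<close> that \<open>e\<close> bounds.\<close>

lemma fifth_minus_fourth_real_bound:
  fixes c y w v :: real
  assumes A: "c\<^sup>2 + 3 * y\<^sup>2 + 5 * w\<^sup>2 + 7 * v\<^sup>2 \<le> 1" and c: "c\<^sup>2 \<le> 2 / 3"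
  shows "2 * v + 3.6 * c * w + 3 * y\<^sup>2 + 4.8 * c\<^sup>2 * y + 0.2 * c ^ 4 \<le> 1.8229"
proof -
  define t where "t = c\<^sup>2"
  have t: "0 \<le> t" "t \<le> 2 / 3" using c by (auto simp: t_def)
  have y: "3 * y\<^sup>2 \<le> 1 - t" using A zero_le_power2[of w] zero_le_power2[of v] unfolding t_def by linarith
  \<comment> \<open>\<open>m\<close> and \<open>s\<close> are the weights in the AM-GM estimates of the bilinear terms.\<close>
  have amgm: "2 * v + 3.6 * c * w + 3 * y\<^sup>2 + 4.8 * c\<^sup>2 * y + 0.2 * c ^ 4 \<le>
     2 / (7 * m) + 1.296 * t / m + m / 2 * (1 - t) + e + 2.4 * t * s + 0.2 * t\<^sup>2"
    if "m > 0" "s > 0" "y\<^sup>2 * (3 - 3 / 2 * m + 2.4 * t / s) \<le> e" for m s e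
  proof -
    have "0 \<le> (7 * m * v - 2)\<^sup>2 / (14 * m)" "0 \<le> (2.5 * m * w - 1.8 * c)\<^sup>2 / (2.5 * m)" "0 \<le> 2.4 * t * ((y - s)\<^sup>2 / s)"
      using that t by auto
    hence "2 * v \<le> 2 / (7 * m) + 7 * m / 2 * v\<^sup>2" "3.6 * c * w \<le> 1.296 * t / m + 2.5 * m * w\<^sup>2" "4.8 * t * y \<le> 2.4 * t * y\<^sup>2 / s + 2.4 * t * s"
      using that by (simp_all add: field_simps power2_eq_square t_def)
    moreover have "m / 2 * (t + 3 * y\<^sup>2 + 5 * w\<^sup>2 + 7 * v\<^sup>2) \<le> m / 2 * 1"
      using A that by (intro mult_left_mono) (auto simp: t_def)
    moreover have "c ^ 4 = t\<^sup>2" by (simp add: t_def)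
    moreover have "m / 2 * (t + 3 * y\<^sup>2 + 5 * w\<^sup>2 + 7 * v\<^sup>2) = m / 2 * t + 3 / 2 * (m * y\<^sup>2) + 2.5 * m * w\<^sup>2 + 7 * m / 2 * v\<^sup>2"
      "y\<^sup>2 * (3 - 3 / 2 * m + 2.4 * t / s) = 3 * y\<^sup>2 - 3 / 2 * (m * y\<^sup>2) + 2.4 * t * y\<^sup>2 / s"
      "m / 2 * (1 - t) = m / 2 - m / 2 * t"
      by (simp_all add: field_simps)
    ultimately show ?thesis using that(3) unfolding t_def[symmetric] by linarith
  qed
  \<comment> \<open>The best weights vary with \<open>t\<close>. For \<open>m = 3\<close>,
    \<open>s = 0.5\<close> the coefficient of \<open>y^2\<close> is negative up to
    \<open>t = 0.3125\<close>; for \<open>m = 3.6\<close>, \<open>s = 0.4\<close> it reaches 0.3 at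
    \<open>t = 0.45\<close>.\<close>
  consider "t \<le> 0.31" | "0.31 \<le> t" "t \<le> 0.45" | "0.45 \<le> t" by linarith
  thus ?thesis
  proof cases
    case 1
    have "y\<^sup>2 * (3 - 3 / 2 * 3 + 2.4 * t / 0.5) \<le> 0" using 1 by (intro mult_nonneg_nonpos) auto
    moreover have "t\<^sup>2 \<le> 0.31 * t" using mult_right_mono[OF 1 t(1)] by (simp add: power2_eq_square)
    ultimately show ?thesis using 1 by (intro order_trans[OF amgm[of 3 "0.5" 0]]) (simp_all, argo?)
  next
    case 2
    have "y\<^sup>2 * (3 - 3 / 2 * 3.6 + 2.4 * t / 0.4) \<le> y\<^sup>2 * 0.3"
      using 2 by (intro mult_left_mono) auto
    hence "y\<^sup>2 * (3 - 3 / 2 * 3.6 + 2.4 * t / 0.4) \<le> 0.1 * (1 - t)" using y by argo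
    moreover have "0 \<le> (t - 0.31) * (0.45 - t)" using 2 by (intro mult_nonneg_nonneg) auto
    hence "t\<^sup>2 \<le> 0.76 * t - 0.1395" by (simp add: power2_eq_square field_simps)
    ultimately show ?thesis using 2 by (intro order_trans[OF amgm[of "3.6" "0.4" "0.1 * (1 - t)"]]) (simp_all, argo?)
  next
    case 3
    have "0 \<le> (t - 0.45) * (2 / 3 - t)" using 3 t by (intro mult_nonneg_nonneg) auto
    hence t2: "t\<^sup>2 \<le> 67 / 60 * t - 0.3" by (simp add: power2_eq_square field_simps)
    show ?thesis
    \<comment> \<open>The bound \<open>y^2 \<le> (1 - t) / 3\<close> is useful only against a
      positive coefficient; a nonpositive one is simply dropped.\<close>
    proof (cases "3 - 3 / 2 * 4.3 + 2.4 * t / 0.36 \<le> 0")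
      case True
      hence "y\<^sup>2 * (3 - 3 / 2 * 4.3 + 2.4 * t / 0.36) \<le> 0" by (intro mult_nonneg_nonpos) auto
      with 3 t2 show ?thesis by (intro order_trans[OF amgm[of "4.3" "0.36" 0]]) (simp_all, argo?)
    next
      case False
      hence "y\<^sup>2 * (3 - 3 / 2 * 4.3 + 2.4 * t / 0.36) \<le> (1 - t) / 3 * (3 - 3 / 2 * 4.3 + 2.4 * t / 0.36)"
        using y by (intro mult_right_mono) auto
      also have "\<dots> = 607 / 180 * t - 1.15 - 20 / 9 * t\<^sup>2"
        by (simp add: power2_eq_square field_simps)
      finally have "y\<^sup>2 * (3 - 3 / 2 * 4.3 + 2.4 * t / 0.36) \<le> 607 / 180 * t - 1.15 - 20 / 9 * t\<^sup>2" .
      moreover have "6 / 5 * t - 9 / 25 \<le> t\<^sup>2"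
        using zero_le_power2[of "t - 3 / 5"] by (simp add: power2_eq_square field_simps)
      ultimately show ?thesis using 3 t
        by (intro order_trans[OF amgm[of "4.3" "0.36" "607 / 180 * t - 1.15 - 20 / 9 * t\<^sup>2"]]) (simp_all, argo?)
    qed
  qed
qed

text \<open>The multiplier \<open>5 / 4 * x\<close> would cancel \<open>x^4\<close>, but
  \<open>5 / 4 * sqrt (2 / 3) > 1\<close>. The smaller \<open>6 / 5 * x\<close> is admissible and
  leaves only \<open>x^4 / 5\<close>.\<close>

lemma fifth_minus_fourth:
  fixes x y w v :: complex
  assumes A: "norm x ^ 2 + 3 * norm y ^ 2 + 5 * norm w ^ 2 + 7 * norm v ^ 2 \<le> 1" and x: "norm x ^ 2 \<le> 2 / 3"
  shows "norm (- 2 * v + 6 * x * w + 3 * y ^ 2 - 12 * x ^ 2 * y + 5 * x ^ 4)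
    - norm (- 2 * w + 6 * x * y - 4 * x ^ 3) \<le> 1.8229"
proof -
  have "(6 / 5 * norm x) ^ 2 \<le> 1 ^ 2" using x by (simp add: power2_eq_square)
  hence "6 / 5 * norm x \<le> 1" by (rule power2_le_imp_le) simp
  hence "norm (- 2 * v + 6 * x * w + 3 * y ^ 2 - 12 * x ^ 2 * y + 5 * x ^ 4) - norm (- 2 * w + 6 * x * y - 4 * x ^ 3)
     \<le> norm (- 2 * v + 6 * x * w + 3 * y ^ 2 - 12 * x ^ 2 * y + 5 * x ^ 4 + (6 / 5 * x) * (- 2 * w + 6 * x * y - 4 * x ^ 3))"
    by (intro norm_diff_le_norm_add_mult) (simp add: norm_mult)
  also have "- 2 * v + 6 * x * w + 3 * y ^ 2 - 12 * x ^ 2 * y + 5 * x ^ 4 + (6 / 5 * x) * (- 2 * w + 6 * x * y - 4 * x ^ 3)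
     = - 2 * v + 18 / 5 * x * w + 3 * y ^ 2 - 24 / 5 * x ^ 2 * y + 1 / 5 * x ^ 4"
    by (simp add: field_simps eval_nat_numeral)
  also have "norm \<dots> \<le> norm (- 2 * v) + norm (18 / 5 * x * w) + norm (3 * y ^ 2) + norm (24 / 5 * x ^ 2 * y) + norm (1 / 5 * x ^ 4)"
    by (intro norm_triangle_le norm_triangle_le_diff add_mono order.refl)
  also have "\<dots> = 2 * norm v + 3.6 * norm x * norm w + 3 * norm y ^ 2 + 4.8 * norm x ^ 2 * norm y + 0.2 * norm x ^ 4"
    by (simp add: norm_mult norm_power norm_divide)
  also have "\<dots> \<le> 1.8229" by (rule fifth_minus_fourth_real_bound[OF A x])
  finally show ?thesis .
qed

theorem theorem2:
  shows "\<exists>d1 \<in> {1.174..<1.175::real}. \<exists>d2 \<in> {1.822..<1.823::real}.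
    \<forall>f \<in> class_Sb. \<forall>a :: nat \<Rightarrow> complex.
      (\<forall>z \<in> ball 0 1. (\<lambda>n. a n * z ^ n) sums f z) \<longrightarrow>
        norm (a 4) - norm (a 3) \<le> d1 \<and> norm (a 5) - norm (a 4) \<le> d2"
proof -
  have "norm (a 4) - norm (a 3) \<le> 1.1749 \<and> norm (a 5) - norm (a 4) \<le> 1.8229"
    if f: "f \<in> class_Sb" and a: "\<forall>z \<in> ball 0 1. (\<lambda>n. a n * z ^ n) sums f z" for f and a :: "nat \<Rightarrow> complex"
  proof -
    have a': "(\<lambda>n. a n * z ^ n) sums f z" if "z \<in> ball 0 1" for z using a that by blast
    have fS: "f \<in> class_S" using f by (simp add: class_Sb_def)
    obtain s b where b: "\<And>z. z \<in> ball 0 1 \<Longrightarrow> (\<lambda>n. b n * z ^ n) sums s z"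
        "\<And>z. z \<in> ball 0 1 \<Longrightarrow> f z * s z ^ 2 = z" "b 0 = 1"
      and areab: "\<And>N. (\<Sum>m<N. m * norm (if 2 dvd Suc m then b (Suc m div 2) else 0) ^ 2) \<le> 1"
      using class_S_root_area[OF fS, of 2, OF zero_less_numeral] by blast
    obtain r p where p: "\<And>z. z \<in> ball 0 1 \<Longrightarrow> (\<lambda>n. p n * z ^ n) sums r z"
        "\<And>z. z \<in> ball 0 1 \<Longrightarrow> f z * r z ^ 3 = z" "p 0 = 1"
      and areap: "\<And>N. (\<Sum>m<N. m * norm (if 3 dvd Suc m then p (Suc m div 3) else 0) ^ 2) \<le> 1"
      using class_S_root_area[OF fS, of 3, OF zero_less_numeral] by blast
    obtain g A where g: "g \<in> class_S" and A: "\<And>z. z \<in> ball 0 1 \<Longrightarrow> (\<lambda>n. A n * z ^ n) sums g z"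
        "A 2 = - a 2" "A 3 = 2 * a 2 ^ 2 - a 3"
      using class_Sb_inverse[OF f a'] by blast
    obtain S B where B: "\<And>z. z \<in> ball 0 1 \<Longrightarrow> (\<lambda>n. B n * z ^ n) sums S z"
        "\<And>z. z \<in> ball 0 1 \<Longrightarrow> g z * S z ^ 2 = z" "B 0 = 1"
      and areaB: "\<And>N. (\<Sum>m<N. m * norm (if 2 dvd Suc m then B (Suc m div 2) else 0) ^ 2) \<le> 1"
      using class_S_root_area[OF g, of 2, OF zero_less_numeral] by blast
    note ab = sqrt_root_coeffs[OF fps_root_relation[OF a' b(1,2)] b(3)]
    note ap = cube_root_coeffs[OF fps_root_relation[OF a' p(1,2)] p(3)]
    note AB = sqrt_root_coeffs[OF fps_root_relation[OF A(1) B(1,2)] B(3)]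
    define x y where "x = b 1" and "y = b 2"
    \<comment> \<open>Both expansions give the same \<open>a 2\<close>, namely
      \<open>- 2 * x = - 3 * p 1\<close>.\<close>
    have p1: "p 1 = 2 / 3 * x" using ab(1) ap(1) by (simp add: x_def)
    have "3 * x\<^sup>2 - 2 * y = 6 * (2 / 3 * x)\<^sup>2 - 3 * p 2"
      using trans[OF ab(2)[symmetric] ap(2)] unfolding p1 by (simp only: x_def y_def)
    hence y: "y = 3 / 2 * p 2 + x\<^sup>2 / 6"
      by (simp add: power2_eq_square field_simps)
    have B1: "B 1 = - x" using AB(1) A(2) ab(1) by (simp add: x_def)
    have "3 * x\<^sup>2 - 2 * B 2 = 2 * (2 * x)\<^sup>2 - (3 * x\<^sup>2 - 2 * y)"
      using trans[OF AB(2)[symmetric] A(3)] ab(1,2) B1 by (simp add: x_def y_def)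
    hence B2: "B 2 = - (x\<^sup>2 + y)" by (simp add: power2_eq_square algebra_simps) algebra
    \<comment> \<open>Index \<open>m\<close> carries root coefficient \<open>(m + 1) / k\<close>, so
      \<open>m < 8\<close> with \<open>k = 2\<close> reaches \<open>b 4\<close>; likewise
      \<open>m < 9\<close> with \<open>k = 3\<close> reaches \<open>p 3\<close>, and
      \<open>m < 4\<close> with \<open>k = 2\<close> reaches \<open>B 2\<close>.\<close>
    have area2: "norm x ^ 2 + 3 * norm y ^ 2 + 5 * norm (b 3) ^ 2 + 7 * norm (b 4) ^ 2 \<le> 1"
      using areab[of 8] by (simp add: lessThan_nat_numeral x_def y_def)
    have area3: "8 / 9 * norm x ^ 2 + 5 * norm (p 2) ^ 2 + 8 * norm (p 3) ^ 2 \<le> 1"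
    proof -
      have "norm (p 1) ^ 2 = 4 / 9 * norm x ^ 2" unfolding p1 by (simp add: norm_mult power_mult_distrib power2_eq_square)
      thus ?thesis using areap[of 9] by (simp add: lessThan_nat_numeral flip: numeral_2_eq_2)
    qed
    have areai: "norm x ^ 2 + 3 * norm (x\<^sup>2 + y) ^ 2 \<le> 1"
    proof -
      have "norm (B 1) ^ 2 + 3 * norm (B 2) ^ 2 \<le> 1" using areaB[of 4] by (simp add: lessThan_nat_numeral)
      thus ?thesis unfolding B1 B2 norm_minus_cancel .
    qed
    have x: "norm x ^ 2 \<le> 2 / 3"
    proof (rule second_coeff_bound[OF _ areai])
      show "norm x ^ 2 + 3 * norm y ^ 2 \<le> 1"
        using area2 zero_le_power2[of "norm (b 3)"] zero_le_power2[of "norm (b 4)"] by linarith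
    qed
    have "norm (a 4) - norm (a 3) \<le> 1.1749"
    proof (cases "norm x \<le> 3 / 4")
      case True
      have "norm x ^ 2 + 3 * norm y ^ 2 + 5 * norm (b 3) ^ 2 \<le> 1"
        using area2 zero_le_power2[of "norm (b 4)"] by linarith
      from fourth_minus_third_small[OF this True] show ?thesis
        by (simp only: ab x_def y_def)
    next
      case False
      have "a 3 = 8 / 3 * x\<^sup>2 - 3 * p 2" "a 4 = - 3 * p 3 + 8 * x * p 2 - 80 / 27 * x ^ 3"
        by (simp_all only: ap p1) (simp_all add: field_simps power2_eq_square power3_eq_cube)
      thus ?thesis
        using fourth_minus_third_large[OF _ x area3] False areai unfolding y by simp
    qed
    moreover have "norm (a 5) - norm (a 4) \<le> 1.8229"
      using fifth_minus_fourth[OF area2 x] by (simp only: ab x_def y_def)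
    ultimately show ?thesis ..
  qed
  thus ?thesis by (intro bexI[of _ "1.1749"] bexI[of _ "1.8229"]) auto
qed

end
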